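(* Let $G$ be a snark, let $\sigma$ be a normal $5$-edge-coloring of $G$, let $C=u_0u_1\cdots u_{g-1}u_0$ be a cycle of length $g$ in $G$, and let $\tilde G$ be a superposition of $G$ along $C$ (as described in the context) determined by supervertex types $\mathcal{A}_i\in\{A,A'\}$, right semiedge permutations $p_i$ and docks $d_i\in\{1,2,3\}$, $i\in\{0,\ldots,g-1\}$. If there exists at least one $i\in\{0,\ldots,g-1\}$ such that $p_i(1)\neq 1$ or $d_i\neq 1$, then there exists a normal $5$-edge-coloring $\tilde\sigma$ of $\tilde G$ with at least $18$ poor edges.
   Context: A snark is a bridgeless cubic graph that is not $3$-edge-colorable. A (proper) $k$-edge-coloring of a graph is a map $\sigma:E\to\{1,\ldots,k\}$ with adjacent edges receiving distinct colors; $\sigma(v)$ denotes the set of colors of the edges incident to $v$. An edge $uv$ is poor if $|\sigma(u)\cup\sigma(v)|=3$ and rich if $|\sigma(u)\cup\sigma(v)|=5$; a proper edge-coloring of a cubic graph is normal if every edge is poor or rich. Petersen superedge: let $P_{10}$ be the Petersen graph, $u,v$ two nonadjacent vertices of $P_{10}$, and $x$ their unique common neighbor. The superedge $(P_{10})_{u,v}$ is obtained by deleting $u$ and $v$ and replacing each of the six edges formerly incident to $u$ or $v$ by a semiedge (a dangling edge) at its remaining endpoint. The three semiedges coming from edges at $u$ are the left semiedges $s^l_1,s^l_2,s^l_3$, where $s^l_1$ is the one at $x$; the three coming from edges at $v$ are the right semiedges $s^r_1,s^r_2,s^r_3$, where $s^r_1$ is the one at $x$. Superposition along a cycle: let $G$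 be a snark and $C=u_0u_1\cdots u_{g-1}u_0$ a cycle in $G$, indices taken modulo $g$. Put $e_i=u_iu_{i+1}$, let $v_i$ be the neighbor of $u_i$ other than $u_{i-1},u_{i+1}$, and $f_i=u_iv_i$. For each $i$ choose a copy $\mathcal{B}_i$ of $(P_{10})_{u,v}$, a permutation $p_i$ of $\{1,2,3\}$ (the right semiedge permutation), a dock $d_i\in\{1,2,3\}$, and a type $\mathcal{A}_i\in\{A,A'\}$. The graph $\tilde G$ is obtained as follows: delete the vertices of $C$ from $G$ (all other vertices and edges are kept; $f_i$ now dangles at $v_i$); for every $i$ and $j\in\{1,2,3\}$, identify the right semiedge $s^r_j$ of $\mathcal{B}_{i-1}$ with the left semiedge $s^l_{p_{i-1}(j)}$ of $\mathcal{B}_i$ to form an edge; the edge so formed with $p_{i-1}(j)=d_i$ is subdivided by a new vertex $u_i$, which is joined to $v_i$. If $\mathcal{A}_i=A$, the other two edges formed between $\mathcal{B}_{i-1}$ and $\mathcal{B}_i$ are left as they are; if $\mathcal{A}_i=A'$, each of these two edges is subdivided by a new vertex, $u_i'$ and $u_i''$ respectively, and the edge $u_i'u_i''$ is added. The result $\tilde G$ is a cubic graph. *)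

theory Defs
  imports Main "HOL-Combinatorics.Permutations"
begin

record 'a graph =
  verts :: "'a set"
  edges :: "'a set set"

definition simple_graph :: "'a graph \<Rightarrow> bool" where
  "simple_graph G \<longleftrightarrow> finite (verts G) \<and> (\<forall>e\<in>edges G. e \<subseteq> verts G \<and> card e = 2)"

definition neighbours :: "'a graph \<Rightarrow> 'a \<Rightarrow> 'a set" where
  "neighbours G v = {w \<in> verts G. {v, w} \<in> edges G}"

definition incident_edges :: "'a graph \<Rightarrow> 'a \<Rightarrow> 'a set set" where
  "incident_edges G v = {e \<in> edges G. v \<in> e}"

definition cubic :: "'a graph \<Rightarrow> bool" where
  "cubic G \<longleftrightarrow> (\<forall>v\<in>verts G. card (incident_edges G v) = 3)"

definition bridge :: "'a graph \<Rightarrow> 'a set \<Rightarrow> bool" where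
  "bridge G e \<longleftrightarrow> e \<in> edges G \<and>
     (\<exists>v w. e = {v, w} \<and> (v, w) \<notin> {(a, b). {a, b} \<in> edges G - {e}}\<^sup>*)"

definition bridgeless :: "'a graph \<Rightarrow> bool" where
  "bridgeless G \<longleftrightarrow> (\<nexists>e. bridge G e)"

definition proper_edge_coloring :: "nat \<Rightarrow> 'a graph \<Rightarrow> ('a set \<Rightarrow> nat) \<Rightarrow> bool" where
  "proper_edge_coloring k G \<sigma> \<longleftrightarrow>
     (\<forall>e\<in>edges G. \<sigma> e \<in> {1..k}) \<and>
     (\<forall>e\<in>edges G. \<forall>f\<in>edges G. e \<noteq> f \<and> e \<inter> f \<noteq> {} \<longrightarrow> \<sigma> e \<noteq> \<sigma> f)"

definition edge_colorable :: "nat \<Rightarrow> 'a graph \<Rightarrow> bool" where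
  "edge_colorable k G \<longleftrightarrow> (\<exists>\<sigma>. proper_edge_coloring k G \<sigma>)"

definition snark :: "'a graph \<Rightarrow> bool" where
  "snark G \<longleftrightarrow> simple_graph G \<and> cubic G \<and> bridgeless G \<and> \<not> edge_colorable 3 G"

definition colors_at :: "'a graph \<Rightarrow> ('a set \<Rightarrow> nat) \<Rightarrow> 'a \<Rightarrow> nat set" where
  "colors_at G \<sigma> v = \<sigma> ` incident_edges G v"

definition poor_edge :: "'a graph \<Rightarrow> ('a set \<Rightarrow> nat) \<Rightarrow> 'a set \<Rightarrow> bool" where
  "poor_edge G \<sigma> e \<longleftrightarrow> e \<in> edges G \<and>
     (\<exists>u v. e = {u, v} \<and> card (colors_at G \<sigma> u \<union> colors_at G \<sigma> v) = 3)"

definition rich_edge :: "'a graph \<Rightarrow> ('a set \<Rightarrow> nat) \<Rightarrow> 'a set \<Rightarrow> bool" where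
  "rich_edge G \<sigma> e \<longleftrightarrow> e \<in> edges G \<and>
     (\<exists>u v. e = {u, v} \<and> card (colors_at G \<sigma> u \<union> colors_at G \<sigma> v) = 5)"

definition normal_edge_coloring :: "nat \<Rightarrow> 'a graph \<Rightarrow> ('a set \<Rightarrow> nat) \<Rightarrow> bool" where
  "normal_edge_coloring k G \<sigma> \<longleftrightarrow> proper_edge_coloring k G \<sigma> \<and>
     (\<forall>e\<in>edges G. poor_edge G \<sigma> e \<or> rich_edge G \<sigma> e)"

definition cycle_in :: "'a graph \<Rightarrow> nat \<Rightarrow> (nat \<Rightarrow> 'a) \<Rightarrow> bool" where
  "cycle_in G g c \<longleftrightarrow> 3 \<le> g \<and> inj_on c {..<g} \<and>
     (\<forall>i<g. c i \<in> verts G \<and> {c i, c (Suc i mod g)} \<in> edges G)"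

definition cycle_edges :: "nat \<Rightarrow> (nat \<Rightarrow> 'a) \<Rightarrow> 'a set set" where
  "cycle_edges g c = {{c i, c (Suc i mod g)} | i. i < g}"

definition cyc_pred :: "nat \<Rightarrow> nat \<Rightarrow> nat" where
  "cyc_pred g i = (i + g - 1) mod g"

definition petersen :: "nat set graph" where
  "petersen = (let V = {A. A \<subseteq> {..<5} \<and> card A = 2} in
     \<lparr> verts = V, edges = {{A, B} | A B. A \<in> V \<and> B \<in> V \<and> A \<inter> B = {}} \<rparr>)"

text \<open>
  A superedge is given by the two deleted vertices together with a labelling of its semiedges:
  \<open>lend j\<close> and \<open>rend j\<close> (for \<open>j \<in> {1, 2, 3}\<close>) are the vertices at which the \<open>j\<close>-th left and the
  \<open>j\<close>-th right semiedge dangle, respectively.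
\<close>

record superedge =
  ldel :: "nat set"
  rdel :: "nat set"
  lend :: "nat \<Rightarrow> nat set"
  rend :: "nat \<Rightarrow> nat set"

definition petersen_superedge :: "superedge \<Rightarrow> bool" where
  "petersen_superedge S \<longleftrightarrow>
     ldel S \<in> verts petersen \<and> rdel S \<in> verts petersen \<and>
     ldel S \<noteq> rdel S \<and> {ldel S, rdel S} \<notin> edges petersen \<and>
     bij_betw (lend S) {1, 2, 3} (neighbours petersen (ldel S)) \<and>
     bij_betw (rend S) {1, 2, 3} (neighbours petersen (rdel S)) \<and>
     neighbours petersen (ldel S) \<inter> neighbours petersen (rdel S) = {lend S 1} \<and>
     rend S 1 = lend S 1"

definition superedge_verts :: "superedge \<Rightarrow> nat set set" where
  "superedge_verts S = verts petersen - {ldel S, rdel S}"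

definition superedge_edges :: "superedge \<Rightarrow> nat set set set" where
  "superedge_edges S = {e \<in> edges petersen. ldel S \<notin> e \<and> rdel S \<notin> e}"

datatype supervertex_type = Type_A | Type_A'

text \<open>
  \<open>Super i w\<close> is the copy of \<open>w\<close> in the \<open>i\<close>-th superedge. \<open>Base v\<close> is a vertex \<open>v\<close> of the original
  graph; for \<open>v = c i\<close> on the cycle it is the new vertex \<open>u\<^sub>i\<close> subdividing the dock.
  \<open>Subdiv i k\<close>, with \<open>k\<close> ranging over the two left semiedges of the \<open>i\<close>-th superedge other than the
  dock, are the vertices \<open>u\<^sub>i'\<close> and \<open>u\<^sub>i''\<close> of a supervertex of type \<open>A'\<close>.
\<close>

datatype 'a sp_vertex = Base 'a | Super nat "nat set" | Subdiv nat nat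

text \<open>
  The edges into which the edge joining the \<open>j\<close>-th right semiedge of superedge \<open>i - 1\<close> to its left
  partner in superedge \<open>i\<close> is possibly subdivided.
\<close>

definition link_edges ::
  "nat \<Rightarrow> (nat \<Rightarrow> 'a) \<Rightarrow> superedge \<Rightarrow> (nat \<Rightarrow> nat \<Rightarrow> nat) \<Rightarrow> (nat \<Rightarrow> nat) \<Rightarrow> (nat \<Rightarrow> supervertex_type)
     \<Rightarrow> nat \<Rightarrow> nat \<Rightarrow> 'a sp_vertex set set" where
  "link_edges g c S p d t i j =
     (let h = cyc_pred g i; k = p h j; a = Super h (rend S j); b = Super i (lend S k) in
      if k = d i then {{a, Base (c i)}, {Base (c i), b}}
      else case t i of
             Type_A \<Rightarrow> {{a, b}}
           | Type_A' \<Rightarrow> {{a, Subdiv i k}, {Subdiv i k, b}})"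

text \<open>
  In a cubic graph, the edges outside \<open>cycle_edges g c\<close> are those avoiding the cycle together with
  the third edge \<open>f\<^sub>i = u\<^sub>i v\<^sub>i\<close> at every cycle vertex. If \<open>f\<^sub>i\<close> is a chord \<open>u\<^sub>i u\<^sub>m\<close>, then the new
  vertices \<open>u\<^sub>i\<close> and \<open>u\<^sub>m\<close> are joined by a single edge.
\<close>

definition superposition ::
  "'a graph \<Rightarrow> nat \<Rightarrow> (nat \<Rightarrow> 'a) \<Rightarrow> superedge \<Rightarrow> (nat \<Rightarrow> nat \<Rightarrow> nat) \<Rightarrow> (nat \<Rightarrow> nat)
     \<Rightarrow> (nat \<Rightarrow> supervertex_type) \<Rightarrow> 'a sp_vertex graph" where
  "superposition G g c S p d t =
     \<lparr> verts = Base ` verts G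
         \<union> {Super i w | i w. i < g \<and> w \<in> superedge_verts S}
         \<union> {Subdiv i k | i k. i < g \<and> t i = Type_A' \<and> k \<in> {1, 2, 3} - {d i}},
       edges = {Base ` e | e. e \<in> edges G - cycle_edges g c}
         \<union> {Super i ` e | i e. i < g \<and> e \<in> superedge_edges S}
         \<union> (\<Union>i\<in>{..<g}. \<Union>j\<in>{1, 2, 3}. link_edges g c S p d t i j)
         \<union> {Subdiv i ` ({1, 2, 3} - {d i}) | i. i < g \<and> t i = Type_A'} \<rparr>"

end

theory Submission
  imports Defs
begin

text \<open>
  Write \<open>T\<^sub>i = {a, b, f}\<close> for the colors of \<open>G\<close> at \<open>u\<^sub>i\<close>, where \<open>a\<close> and \<open>b\<close> are the colors of the
  cycle edges entering and leaving \<open>u\<^sub>i\<close>. All edges of \<open>G\<close> outside the cycle keep their color, every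
  vertex of the supervertex \<open>i\<close> sees the set \<open>T\<^sub>i\<close>, and every vertex of the superedge \<open>i\<close> sees \<open>T\<^sub>i\<close> or
  \<open>T\<^sub>i\<^sub>+\<^sub>1\<close>; so normality of an edge of the superposition follows from normality of \<open>u\<^sub>iu\<^sub>i\<^sub>+\<^sub>1\<close> in \<open>G\<close>.
  The left semiedges of superedge \<open>i\<close> carry \<open>b\<close> at one position \<open>m\<close> and a common color at the other two,
  and the right semiedges carry \<open>b\<close> at one position \<open>k\<close> and a common color at the other two. The Petersen
  superedge has such a coloring, with at least six poor edges, if exactly one of \<open>m\<close>, \<open>k\<close> is \<open>1\<close>. Hence a
  supervertex with \<open>p(1) = 1\<close> and \<open>d = 1\<close> forces the truth value of \<open>m = 1\<close> to alternate, while any other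
  supervertex can be entered from a superedge with \<open>m = 1\<close> and left with either value, which makes it
  possible to close the cycle. As \<open>g \<ge> 3\<close>, there are at least \<open>18\<close> poor edges.
\<close>

section \<open>Normal colorings described by labelled edges\<close>

text \<open>Bijectivity at a vertex serves twice: injectivity of \<open>\<kappa>\<close> makes the
  coloring proper, and surjectivity identifies \<open>W v\<close> as the color set at
  \<open>v\<close>. Poor and rich edges can then be read off from \<open>W\<close> alone.
  Injectivity of \<open>ends\<close> makes the transfer from labels to edges well defined.\<close>

lemma normal_edge_coloring_by_labels:
  fixes ends :: "'l \<Rightarrow> 'v set" and \<kappa> :: "'l \<Rightarrow> nat" and W :: "'v \<Rightarrow> nat set"
  assumes edges: "edges H = ends ` X" and inj: "inj_on ends X"
    and bij: "\<And>v. v \<in> \<Union>(ends ` X) \<Longrightarrow> bij_betw \<kappa> {l \<in> X. v \<in> ends l} (W v)"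
    and colors: "\<And>v. v \<in> \<Union>(ends ` X) \<Longrightarrow> W v \<subseteq> {1..5}"
    and ends: "\<And>l. l \<in> X \<Longrightarrow> \<exists>u v. ends l = {u, v} \<and> card (W u \<union> W v) \<in> {3, 5}"
  obtains \<tau> where "normal_edge_coloring 5 H \<tau>"
    "\<And>l u v. l \<in> X \<Longrightarrow> ends l = {u, v} \<Longrightarrow> card (W u \<union> W v) = 3 \<Longrightarrow> poor_edge H \<tau> (ends l)"
proof -
  define \<tau> where "\<tau> = \<kappa> \<circ> the_inv_into X ends"
  have \<tau>: "\<tau> (ends l) = \<kappa> l" if "l \<in> X" for l
    using that inj by (simp add: \<tau>_def the_inv_into_f_f)
  have at: "colors_at H \<tau> v = W v" if "v \<in> \<Union>(ends ` X)" for v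
  proof -
    have "incident_edges H v = ends ` {l \<in> X. v \<in> ends l}"
      by (auto simp: incident_edges_def edges)
    then have "colors_at H \<tau> v = \<kappa> ` {l \<in> X. v \<in> ends l}"
      by (auto simp: colors_at_def image_image \<tau> intro!: image_eqI)
    then show ?thesis
      using bij[OF that] by (simp add: bij_betw_def)
  qed
  have at_ends: "colors_at H \<tau> u = W u \<and> colors_at H \<tau> v = W v"
    if "l \<in> X" "ends l = {u, v}" for l u v
    using that by (auto intro!: at bexI[of _ l])
  have "proper_edge_coloring 5 H \<tau>"
    unfolding proper_edge_coloring_def
  proof (intro conjI ballI impI)
    fix e assume "e \<in> edges H"
    then obtain l where l: "l \<in> X" "e = ends l"
      using edges by auto
    then obtain u where u: "u \<in> ends l"
      using ends by blast
    then have uX: "u \<in> \<Union>(ends ` X)"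
      using l by blast
    then have "\<kappa> l \<in> W u"
      using bij[of u] l u by (auto simp: bij_betw_def)
    then show "\<tau> e \<in> {1..5}"
      using colors[OF uX] l \<tau> by auto
  next
    fix e f assume "e \<in> edges H" "f \<in> edges H" and ef: "e \<noteq> f \<and> e \<inter> f \<noteq> {}"
    then obtain l k v where l: "l \<in> X" "e = ends l" "k \<in> X" "f = ends k" "v \<in> ends l" "v \<in> ends k"
      using edges by auto
    then have "inj_on \<kappa> {l \<in> X. v \<in> ends l}"
      using bij[of v] by (auto simp: bij_betw_def)
    then have "\<kappa> l \<noteq> \<kappa> k"
      using l ef by (auto dest!: inj_onD)
    then show "\<tau> e \<noteq> \<tau> f"
      using l \<tau> by simp
  qed
  moreover have "poor_edge H \<tau> e \<or> rich_edge H \<tau> e" if e: "e \<in> edges H" for e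
  proof -
    obtain l where l: "l \<in> X" "e = ends l"
      using e edges by auto
    then obtain u v where uv: "ends l = {u, v}" "card (W u \<union> W v) \<in> {3, 5}"
      using ends by blast
    have "card (colors_at H \<tau> u \<union> colors_at H \<tau> v) \<in> {3, 5}"
      using at_ends[OF l(1) uv(1)] uv(2) by simp
    then show ?thesis
      using e uv(1) l(2) unfolding poor_edge_def rich_edge_def by auto
  qed
  moreover have "poor_edge H \<tau> (ends l)"
    if l: "l \<in> X" "ends l = {u, v}" "card (W u \<union> W v) = 3" for l u v
  proof -
    have "card (colors_at H \<tau> u \<union> colors_at H \<tau> v) = 3"
      using at_ends[OF l(1,2)] l(3) by simp
    then show ?thesis
      using l(1,2) unfolding poor_edge_def by (auto simp: edges)
  qed
  ultimately show thesis
    by (intro that) (auto simp: normal_edge_coloring_def)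
qed

section \<open>Choice of states around the cycle\<close>

text \<open>Strict alternation around a cycle of odd length is impossible. An exceptional index
  removes the obstruction: it forces only the value before it and leaves the value at it free, so
  values can be assigned backwards from the next exceptional index.\<close>

lemma alternating_states:
  assumes "0 < g" "q < g" "exc q"
  obtains s :: "nat \<Rightarrow> bool" where
    "\<And>i. i < g \<Longrightarrow> exc (Suc i mod g) \<Longrightarrow> s i"
    "\<And>i. i < g \<Longrightarrow> \<not> exc (Suc i mod g) \<Longrightarrow> s i \<longleftrightarrow> \<not> s (Suc i mod g)"
proof
  \<comment> \<open>the number of steps from \<open>Suc i\<close> to the next exceptional index\<close>
  define N where "N i = (LEAST n. exc ((Suc i + n) mod g))" for i
  show "even (N i)" if "exc (Suc i mod g)" for i
  proof -
    have "N i = 0"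
      unfolding N_def using that by (intro Least_eq_0) simp
    then show ?thesis by simp
  qed
  show "even (N i) \<longleftrightarrow> \<not> even (N (Suc i mod g))" if i: "i < g" "\<not> exc (Suc i mod g)" for i
  proof -
    \<comment> \<open>Witness that some number of steps reaches an exceptional index; the least such
      number is positive because \<open>Suc i mod g\<close> is not exceptional. The summand
      \<open>g\<close> keeps the subtraction of naturals exact.\<close>
    have "(Suc i + (q + g - Suc i)) mod g = q"
      using i assms by simp
    then have "exc ((Suc i + (q + g - Suc i)) mod g)"
      using assms by simp
    then have "N i = Suc (LEAST n. exc ((Suc i + Suc n) mod g))"
      unfolding N_def using i(2) by (intro Least_Suc) auto
    also have "(\<lambda>n. exc ((Suc i + Suc n) mod g)) = (\<lambda>n. exc ((Suc (Suc i mod g) + n) mod g))"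
      by (intro ext arg_cong[of _ _ exc]) (metis add_Suc_shift mod_add_left_eq add_Suc_right)
    finally show ?thesis
      by (simp add: N_def)
  qed
qed

text \<open>
  The words on the two sides of a supervertex, both indexed by left semiedges: \<open>a\<close> at position \<open>q\<close> on
  the incoming side, \<open>b\<close> at position \<open>m\<close> on the outgoing side. \<open>P\<close> and \<open>Q\<close> state that the superedge
  before, respectively after, the supervertex has its left special position at \<open>1\<close>; \<open>\<pi>\<close> is the position of the
  right semiedge \<open>1\<close>, \<open>\<delta>\<close> the dock and \<open>y\<close> the color of the rung of a supervertex of type \<open>A'\<close>.
\<close>

lemma link_words:
  fixes a b f \<delta> \<pi> :: nat
  assumes dist: "a \<noteq> b" "a \<noteq> f" "b \<noteq> f" and \<delta>: "\<delta> \<in> {1, 2, 3}" and \<pi>: "\<pi> \<in> {1, 2, 3}"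
    and notP: "\<not> P \<Longrightarrow> \<pi> = 1 \<and> \<delta> = 1 \<and> Q" and PQ: "P \<Longrightarrow> Q \<Longrightarrow> \<pi> \<noteq> 1 \<or> \<delta> \<noteq> 1"
  obtains q m z z' y :: nat where "q \<in> {1, 2, 3}" "m \<in> {1, 2, 3}" "q = \<pi> \<longleftrightarrow> \<not> P" "m = 1 \<longleftrightarrow> Q"
    "z \<in> {a, b, f}" "z = b \<longrightarrow> m = 1" "z' \<in> {b, f}"
    "{if \<delta> = q then a else z', if \<delta> = m then b else z} = {a, b}"
    "\<And>k. k \<in> {1, 2, 3} - {\<delta>} \<Longrightarrow> t = Type_A \<Longrightarrow>
       (if k = q then a else z') = (if k = m then b else z)"
    "\<And>k. k \<in> {1, 2, 3} - {\<delta>} \<Longrightarrow> t = Type_A' \<Longrightarrow>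
       {if k = q then a else z', if k = m then b else z, y} = {a, b, f}"
proof -
  note witness = that
  \<comment> \<open>Pattern with both special positions at the dock.\<close>
  have I: thesis if "\<delta> = \<pi> \<longleftrightarrow> \<not> P" "\<delta> = 1 \<longleftrightarrow> Q"
    using that \<delta> dist by (intro witness[of \<delta> \<delta> f "if t = Type_A then f else b" a]) auto
  \<comment> \<open>Neither special position is at the dock, so the constant colors \<open>b\<close>
    and \<open>a\<close> meet there. Type \<open>A\<close> needs distinct special positions to make
    the halves agree; type \<open>A'\<close> needs equal ones, which leaves \<open>f\<close> for the
    rung.\<close>
  have II: thesis
    if "q \<in> {1, 2, 3}" "m \<in> {1, 2, 3}" "q \<noteq> \<delta>" "m \<noteq> \<delta>" "q = \<pi> \<longleftrightarrow> \<not> P" "m = 1 \<longleftrightarrow> Q"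
      "t = Type_A \<longleftrightarrow> q \<noteq> m" for q m
    using that \<delta> dist by (intro witness[of q m a b f]) auto
  \<comment> \<open>The outgoing side is constantly \<open>b\<close>; this is allowed because
    \<open>Q\<close> asks for \<open>m = 1\<close>.\<close>
  have III: thesis if "\<delta> = \<pi> \<longleftrightarrow> \<not> P" Q
    using that \<delta> dist by (intro witness[of \<delta> 1 b "if t = Type_A then b else f" a]) auto
  show thesis
  \<comment> \<open>Patterns I and III cover exactly this condition. If it fails, then
    \<open>P\<close> holds and both special positions can be moved off the dock.\<close>
  proof (cases "(\<delta> = \<pi> \<longleftrightarrow> \<not> P) \<and> (\<delta> = 1 \<longrightarrow> Q)")
    case True
    then show thesis using I III by blast
  next
    case False
    then have P: P and d: "\<delta> = \<pi> \<or> \<delta> = 1 \<and> \<not> Q"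
      using notP by blast+
    show thesis
    proof (cases "\<delta> = 1")
      case True
      then have nQ: "\<not> Q" using d PQ P by auto
      obtain q :: nat where "q \<in> {2, 3}" "q \<noteq> \<pi>"
        using that[of 2] that[of 3] by (cases "\<pi> = 2") auto
      \<comment> \<open>\<open>5 - q\<close> is the other element of \<open>{2, 3}\<close>.\<close>
      then show thesis
        using nQ P True by (cases t; intro II[of q "if t = Type_A then 5 - q else q"]) auto
    next
      case d1: False
      then have "\<delta> = \<pi>" using d by blast
      show thesis
        using \<delta> d1 P \<open>\<delta> = \<pi>\<close>
        by (cases t; cases Q; intro II[of "if (t = Type_A) = Q then 5 - \<delta> else 1" "if Q then 1 else 5 - \<delta>"]) auto
    qed
  qed
qed

subsection \<open>Colorings of the Petersen superedge\<close>

text \<open>Semiedges need names of their own: \<open>LeftEnd 1\<close> and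
  \<open>RightEnd 1\<close> dangle at the same vertex.\<close>

datatype half_edge = Inner "nat set set" | LeftEnd nat | RightEnd nat

definition star :: "superedge \<Rightarrow> nat set \<Rightarrow> half_edge set" where
  "star S w = Inner ` {e \<in> superedge_edges S. w \<in> e}
     \<union> LeftEnd ` {k \<in> {1, 2, 3}. lend S k = w} \<union> RightEnd ` {k \<in> {1, 2, 3}. rend S k = w}"

text \<open>
  \<open>W w\<close> is the set of colors at \<open>w\<close>, and \<open>e\<close> is the color of the cycle edge replaced by the superedge.
  A semiedge whose end does not already have the color set of the adjoining supervertex has color \<open>e\<close>.
\<close>

definition superedge_coloring ::
  "superedge \<Rightarrow> nat set \<Rightarrow> nat set \<Rightarrow> nat \<Rightarrow> (nat \<Rightarrow> nat) \<Rightarrow> (nat \<Rightarrow> nat)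
     \<Rightarrow> (half_edge \<Rightarrow> nat) \<Rightarrow> (nat set \<Rightarrow> nat set) \<Rightarrow> bool" where
  "superedge_coloring S T T' e lc rc \<chi> W \<longleftrightarrow>
     (\<forall>w\<in>superedge_verts S. W w \<in> {T, T'} \<and> bij_betw \<chi> (star S w) (W w)) \<and>
     (\<forall>k\<in>{1, 2, 3}. \<chi> (LeftEnd k) = lc k \<and> (W (lend S k) = T \<or> lc k = e)) \<and>
     (\<forall>k\<in>{1, 2, 3}. \<chi> (RightEnd k) = rc k \<and> (W (rend S k) = T' \<or> rc k = e)) \<and>
     6 \<le> card {e \<in> superedge_edges S. \<forall>u\<in>e. \<forall>v\<in>e. W u = W v}"

lemma card_2_member:
  assumes "card A = 2" "a \<in> A"
  shows "\<exists>b. A = {a, b} \<and> a \<noteq> b"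
  using assms by (metis card_2_iff doubleton_eq_iff insertE singletonD)

lemma petersen_superedgeD:
  assumes "petersen_superedge S"
  shows "ldel S \<in> verts petersen" "rdel S \<in> verts petersen" "{ldel S, rdel S} \<notin> edges petersen"
    "bij_betw (lend S) {1, 2, 3} (neighbours petersen (ldel S))"
    "bij_betw (rend S) {1, 2, 3} (neighbours petersen (rdel S))"
    "neighbours petersen (ldel S) \<inter> neighbours petersen (rdel S) = {lend S 1}"
    "rend S 1 = lend S 1"
  using assms by (simp_all add: petersen_superedge_def)

text \<open>With deleted vertices \<open>{a, b}\<close> and \<open>{a, c}\<close>, the remaining
  2-subsets are \<open>x = {d, e}\<close>, \<open>y = {b, c}\<close>, the left ends
  \<open>{c, d}\<close> and \<open>{c, e}\<close>, the right ends \<open>{b, d}\<close> and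
  \<open>{b, e}\<close>, and \<open>n = {a, e}\<close>, \<open>n' = {a, d}\<close>. Exchanging
  \<open>d\<close> and \<open>e\<close> makes \<open>r\<close> the right end with the prescribed
  number \<open>k\<close>; then \<open>j\<close> is determined.\<close>

lemma superedge_coordinates:
  assumes S: "petersen_superedge S" and k: "k \<in> {2, 3}"
  obtains x y l l' r r' n n' j where "distinct [x, y, l, l', r, r', n, n']"
    "superedge_verts S = {x, y, l, l', r, r', n, n'}"
    "superedge_edges S =
      {{x, y}, {y, n}, {y, n'}, {l, r'}, {l, n}, {l', r}, {l', n'}, {r, n}, {r', n'}}"
    "lend S 1 = x" "rend S 1 = x" "j \<in> {2, 3}" "lend S j = l" "lend S (5 - j) = l'"
    "rend S k = r" "rend S (5 - k) = r'"
proof -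
  have V: "verts petersen = {A. A \<subseteq> {..<5} \<and> card A = 2}"
    by (simp add: petersen_def Let_def)
  have E: "{A, B} \<in> edges petersen \<longleftrightarrow> A \<in> verts petersen \<and> B \<in> verts petersen \<and> A \<inter> B = {}" for A B
    by (auto simp: petersen_def Let_def doubleton_eq_iff)
  have uv: "ldel S \<in> verts petersen" "rdel S \<in> verts petersen" "ldel S \<noteq> rdel S" "ldel S \<inter> rdel S \<noteq> {}"
    using S E unfolding petersen_superedge_def by auto
  \<comment> \<open>Distinct nonadjacent vertices are 2-subsets with a common point.\<close>
  obtain a where a: "a \<in> ldel S" "a \<in> rdel S"
    using uv(4) by blast
  obtain b where ab: "ldel S = {a, b}" "a \<noteq> b"
    using card_2_member[of "ldel S" a] uv(1) a(1) unfolding V by auto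
  obtain c where c: "rdel S = {a, c}" "a \<noteq> c"
    using card_2_member[of "rdel S" a] uv(2) a(2) unfolding V by auto
  have bc: "b \<noteq> c" using uv(3) ab c by auto
  have five: "{a, b, c} \<subseteq> {..<5}"
    using uv(1,2) ab c unfolding V by auto
  then have "card ({..<5} - {a, b, c}) = 2"
    using ab c bc by (subst card_Diff_subset) auto
  then obtain d' e' where de': "{..<5} - {a, b, c} = {d', e'}" "d' \<noteq> e'"
    unfolding card_2_iff by auto
  have dist': "distinct [a, b, c, d', e']" and univ': "{..<5} = {a, b, c, d', e'}"
    using ab c bc de' five by auto
  \<comment> \<open>Stated for variable \<open>d\<close> and \<open>e\<close>, since the list is
    used both before and after the renaming of \<open>d'\<close> and \<open>e'\<close>.\<close>
  have pairs: "{A. A \<subseteq> {a, b, c, d, e} \<and> card A = 2} =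
      {{a, b}, {a, c}, {a, d}, {a, e}, {b, c}, {b, d}, {b, e}, {c, d}, {c, e}, {d, e}}"
    if "distinct [a, b, c, d, e]" for d e
  proof (intro equalityI subsetI)
    fix A assume "A \<in> {A. A \<subseteq> {a, b, c, d, e} \<and> card A = 2}"
    then obtain x y where A: "A = {x, y}" "x \<noteq> y" and xy: "x \<in> {a, b, c, d, e}" "y \<in> {a, b, c, d, e}"
      by (auto simp: card_2_iff)
    show "A \<in> {{a, b}, {a, c}, {a, d}, {a, e}, {b, c}, {b, d}, {b, e}, {c, d}, {c, e}, {d, e}}"
      using xy A by (elim insertE emptyE) (simp_all add: doubleton_eq_iff)
  next
    fix A assume "A \<in> {{a, b}, {a, c}, {a, d}, {a, e}, {b, c}, {b, d}, {b, e}, {c, d}, {c, e}, {d, e}}"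
    then show "A \<in> {A. A \<subseteq> {a, b, c, d, e} \<and> card A = 2}"
      by (elim insertE emptyE) (use that in simp_all)
  qed
  have nb: "neighbours petersen (ldel S) = {{d', e'}, {c, d'}, {c, e'}}"
    "neighbours petersen (rdel S) = {{d', e'}, {b, d'}, {b, e'}}"
    unfolding neighbours_def E V univ' pairs[OF dist'] ab c using dist' by auto
  have ends: "lend S ` {1, 2, 3} = {{d', e'}, {c, d'}, {c, e'}}" "inj_on (lend S) {1, 2, 3}"
    "rend S ` {1, 2, 3} = {{d', e'}, {b, d'}, {b, e'}}" "inj_on (rend S) {1, 2, 3}"
    using petersen_superedgeD(4,5)[OF S] unfolding bij_betw_def nb by simp_all
  note common = petersen_superedgeD(6,7)[OF S, unfolded nb]
  have "{d', e'} \<in> {lend S 1}"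
    unfolding common(1)[symmetric] by simp
  then have lend1: "lend S 1 = {d', e'}"
    by simp
  have rest: "{s 2, s 3} = s ` {1, 2, 3} - {s 1}" if "inj_on s {1, 2, 3}" for s :: "nat \<Rightarrow> nat set"
    using that by (auto simp: inj_on_def)
  have lend23: "{lend S 2, lend S 3} = {{c, d'}, {c, e'}}"
    unfolding rest[OF ends(2)] ends(1) lend1 using dist' by (simp add: doubleton_eq_iff insert_Diff_if)
  have "{rend S 2, rend S 3} = {{b, d'}, {b, e'}}"
    unfolding rest[OF ends(4)] ends(3) common(2) lend1 using dist' by (simp add: doubleton_eq_iff insert_Diff_if)
  moreover have "{rend S k, rend S (5 - k)} = {rend S 2, rend S 3}"
    using k by auto
  ultimately have "{rend S k, rend S (5 - k)} = {{b, d'}, {b, e'}}"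
    by simp
  \<comment> \<open>The right end number \<open>k\<close> decides which of the two points is called
    \<open>d\<close>.\<close>
  then obtain d e where de: "{d, e} = {d', e'}" "rend S k = {b, d}" "rend S (5 - k) = {b, e}"
    unfolding doubleton_eq_iff by (metis insert_commute)
  have dist: "distinct [a, b, c, d, e]" and univ: "{..<5} = {a, b, c, d, e}"
    using dist' univ' de(1) by (auto simp: doubleton_eq_iff)
  have "{lend S 2, lend S 3} = {{c, d}, {c, e}}"
    using lend23 de(1) by (auto simp: doubleton_eq_iff)
  then have "lend S 2 = {c, d} \<and> lend S 3 = {c, e} \<or> lend S 3 = {c, d} \<and> lend S 2 = {c, e}"
    by (auto simp: doubleton_eq_iff)
  then obtain j where j: "j \<in> {2, 3}" "lend S j = {c, d}" "lend S (5 - j) = {c, e}"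
    using that[of 2] that[of 3] by auto
  \<comment> \<open>Each of the nine edges is listed in one orientation only.\<close>
  define P where "P = {({d, e}, {b, c}), ({b, c}, {a, e}), ({b, c}, {a, d}), ({c, d}, {b, e}), 
      ({c, d}, {a, e}), ({c, e}, {b, d}), ({c, e}, {a, d}), ({b, d}, {a, e}), ({b, e}, {a, d})}"
  define V' where "V' = {{d, e}, {b, c}, {c, d}, {c, e}, {b, d}, {b, e}, {a, e}, {a, d}}"
  have verts: "superedge_verts S = V'"
    unfolding superedge_verts_def V univ pairs[OF dist] V'_def ab c using dist by (auto simp: doubleton_eq_iff)
  have "superedge_edges S = {{A, B} | A B. A \<in> V' \<and> B \<in> V' \<and> A \<inter> B = {}}"
    unfolding superedge_edges_def verts[symmetric] superedge_verts_def by (auto simp: petersen_def Let_def)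
  also have "\<dots> = {{A, B} | A B. (A, B) \<in> P}"
  proof -
    have 1: "A \<in> V' \<and> B \<in> V' \<and> A \<inter> B = {}" if "(A, B) \<in> P" for A B
      using that dist unfolding P_def V'_def by auto
    have 2: "(A, B) \<in> P \<or> (B, A) \<in> P" if A: "A \<in> V'" and B: "B \<in> V'" and dis: "A \<inter> B = {}" for A B
      using A[unfolded V'_def] B[unfolded V'_def] dis dist unfolding P_def
      by (elim insertE emptyE) simp_all
    show ?thesis
    proof (intro equalityI subsetI)
      fix f assume "f \<in> {{A, B} | A B. A \<in> V' \<and> B \<in> V' \<and> A \<inter> B = {}}"
      then obtain A B where "f = {A, B}" "(A, B) \<in> P \<or> (B, A) \<in> P"
        using 2 by blast
      moreover have "{A, B} = {B, A}"
        by (rule insert_commute)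
      ultimately show "f \<in> {{A, B} | A B. (A, B) \<in> P}"
        by blast
    next
      fix f assume "f \<in> {{A, B} | A B. (A, B) \<in> P}"
      then show "f \<in> {{A, B} | A B. A \<in> V' \<and> B \<in> V' \<and> A \<inter> B = {}}"
        using 1 by blast
    qed
  qed
  also have "\<dots> = (\<lambda>(A, B). {A, B}) ` P"
    by auto
  also have "\<dots> = {{{d, e}, {b, c}}, {{b, c}, {a, e}}, {{b, c}, {a, d}}, {{c, d}, {b, e}}, {{c, d}, {a, e}},
      {{c, e}, {b, d}}, {{c, e}, {a, d}}, {{b, d}, {a, e}}, {{b, e}, {a, d}}}"
    unfolding P_def by (simp only: image_insert image_empty prod.case)
  finally have edges: "superedge_edges S = \<dots>" .
  have "distinct [{d, e}, {b, c}, {c, d}, {c, e}, {b, d}, {b, e}, {a, e}, {a, d}]"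
    using dist by (auto simp: doubleton_eq_iff)
  then show thesis
    using lend1 common(2) de verts[unfolded V'_def] edges j
    by (intro that[of "{d, e}" "{b, c}" "{c, d}" "{c, e}" "{b, d}" "{b, e}" "{a, e}" "{a, d}" j]) simp_all
qed

lemma Collect_insert_conj: "{e \<in> insert a A. P e} = (if P a then insert a {e \<in> A. P e} else {e \<in> A. P e})"
  by auto

lemma superedge_stars:
  assumes dist: "distinct [x, y, l, l', r, r', n, n']"
    and edges: "superedge_edges S =
      {{x, y}, {y, n}, {y, n'}, {l, r'}, {l, n}, {l', r}, {l', n'}, {r, n}, {r', n'}}"
    and ends: "lend S 1 = x" "rend S 1 = x" "lend S j = l" "lend S (5 - j) = l'"
      "rend S k = r" "rend S (5 - k) = r'"
    and jk: "j \<in> {2, 3}" "k \<in> {2, 3}"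
  shows "star S x = {Inner {x, y}, LeftEnd 1, RightEnd 1}"
    "star S y = {Inner {x, y}, Inner {y, n}, Inner {y, n'}}"
    "star S l = {Inner {l, r'}, Inner {l, n}, LeftEnd j}"
    "star S l' = {Inner {l', r}, Inner {l', n'}, LeftEnd (5 - j)}"
    "star S r = {Inner {l', r}, Inner {r, n}, RightEnd k}"
    "star S r' = {Inner {l, r'}, Inner {r', n'}, RightEnd (5 - k)}"
    "star S n = {Inner {y, n}, Inner {l, n}, Inner {r, n}}"
    "star S n' = {Inner {y, n'}, Inner {l', n'}, Inner {r', n'}}"
proof -
  have "{1, 2, 3} = {1, j, 5 - j}" "{1, 2, 3} = {1, k, 5 - k}"
    using jk by auto
  then have star: "star S w = Inner ` {e \<in> superedge_edges S. w \<in> e}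
     \<union> LeftEnd ` {i \<in> {1, j, 5 - j}. lend S i = w} \<union> RightEnd ` {i \<in> {1, k, 5 - k}. rend S i = w}" for w
    unfolding star_def by metis
  \<comment> \<open>together with \<open>dist\<close>, this gives the simplifier every inequality in both orientations\<close>
  have rev: "distinct [n', n, r', r, l', l, y, x]"
    by (subst distinct_rev[symmetric]) (use dist in \<open>simp only: rev.simps append.simps\<close>)
  show "star S x = {Inner {x, y}, LeftEnd 1, RightEnd 1}"
    "star S y = {Inner {x, y}, Inner {y, n}, Inner {y, n'}}"
    "star S l = {Inner {l, r'}, Inner {l, n}, LeftEnd j}"
    "star S l' = {Inner {l', r}, Inner {l', n'}, LeftEnd (5 - j)}"
    "star S r = {Inner {l', r}, Inner {r, n}, RightEnd k}"
    "star S r' = {Inner {l, r'}, Inner {r', n'}, RightEnd (5 - k)}"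
    "star S n = {Inner {y, n}, Inner {l, n}, Inner {r, n}}"
    "star S n' = {Inner {y, n'}, Inner {l', n'}, Inner {r', n'}}"
    unfolding star edges Collect_insert_conj using dist rev by (simp_all add: ends insert_commute del: One_nat_def)
qed

lemma card_3_third:
  assumes "card A = 3" "x \<in> A" "y \<in> A" "x \<noteq> y"
  shows "\<exists>z. A = {x, y, z} \<and> z \<noteq> x \<and> z \<noteq> y"
proof -
  have "card (A - {x, y}) = 1"
    using assms by (simp add: card_Diff_subset)
  then obtain z where "A - {x, y} = {z}"
    by (auto simp: card_1_singleton_iff)
  then show ?thesis
    using assms by auto
qed

lemma bij_betw_three:
  assumes "B = {f p, f q, f r}" "f p \<noteq> f q" "f p \<noteq> f r" "f q \<noteq> f r"
  shows "bij_betw f {p, q, r} B"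
  using assms by (auto simp: bij_betw_def inj_on_def)

lemma bij_betw_of_card_le:
  assumes "f ` A = B" "finite A" "card A \<le> card B"
  shows "bij_betw f A B"
  using assms by (metis bij_betw_def card_image_le eq_card_imp_inj_on le_antisym)

text \<open>If \<open>z = e\<close>, all left semiedges have color \<open>e\<close>, so
  \<open>T'\<close> is admissible at every vertex and all nine inner edges qualify. Otherwise the
  color set changes only across three inner edges of color \<open>e\<close>, and the other six
  qualify.\<close>

lemma superedge_coloring_left:
  assumes S: "petersen_superedge S" and k: "k \<in> {2, 3}"
    and T: "card T = 3" "e \<in> T" "z \<in> T" and T': "card T' = 3" "e \<in> T'" "z' \<in> T'" "z' \<noteq> e"
  shows "\<exists>\<chi> W. superedge_coloring S T T' e
    (\<lambda>i. if i = 1 then e else z) (\<lambda>i. if i = k then e else z') \<chi> W"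
proof -
  obtain y' where y': "T' = {e, z', y'}" "y' \<noteq> e" "y' \<noteq> z'"
    using card_3_third[of T' e z'] T' by blast
  obtain x w l l' r r' n n' j where dist: "distinct [x, w, l, l', r, r', n, n']"
    and verts: "superedge_verts S = {x, w, l, l', r, r', n, n'}"
    and edges: "superedge_edges S =
      {{x, w}, {w, n}, {w, n'}, {l, r'}, {l, n}, {l', r}, {l', n'}, {r, n}, {r', n'}}"
    and ends: "lend S 1 = x" "rend S 1 = x" "lend S j = l" "lend S (5 - j) = l'"
      "rend S k = r" "rend S (5 - k) = r'"
    and j: "j \<in> {2, 3}"
    using superedge_coordinates[OF S k] by metis
  note stars = superedge_stars[OF dist edges ends j k]
  have idx: "{1, 2, 3} = {1, j, 5 - j}" "{1, 2, 3} = {1, k, 5 - k}" "j \<noteq> 1" "5 - j \<noteq> 1" "k \<noteq> 1" "5 - k \<noteq> k"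
    using j k by auto
  have rev: "distinct [n', n, r', r, l', l, w, x]"
    by (subst distinct_rev[symmetric]) (use dist in \<open>simp only: rev.simps append.simps\<close>)
  have card_edges: "distinct [{x, w}, {w, n}, {w, n'}, {l, r'}, {l, n}, {l', r}, {l', n'}, {r, n}, {r', n'}]"
    using dist rev by (simp add: doubleton_eq_iff)
  have card_E: "card (superedge_edges S) = 9"
    unfolding edges using distinct_card[OF card_edges] by (simp only: list.set list.size)
  let ?lc = "\<lambda>i. if i = 1 then e else z" and ?rc = "\<lambda>i. if i = k then e else z'"
  define color :: "(nat set set \<Rightarrow> nat) \<Rightarrow> half_edge \<Rightarrow> nat" where
    "color h = case_half_edge h ?lc ?rc" for h
  have color: "color h (Inner f) = h f" "color h (LeftEnd 1) = e" "color h (LeftEnd j) = z"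
    "color h (LeftEnd (5 - j)) = z" "color h (RightEnd 1) = z'" "color h (RightEnd k) = e"
     "color h (RightEnd (5 - k)) = z'" for h f
    using idx by (simp_all add: color_def)
  show ?thesis
  proof (cases "z = e")
    case True
    \<comment> \<open>a proper coloring with the three colors of \<open>T'\<close> only\<close>
    define h where "h f = (if f \<in> {{l, n}, {l', r}, {w, n'}} then z'
      else if f \<in> {{w, n}, {r', n'}} then e else y')" for f
    have h: "h {x, w} = y'" "h {w, n} = e" "h {w, n'} = z'" "h {l, r'} = y'" "h {l, n} = z'"
      "h {l', r} = z'" "h {l', n'} = y'" "h {r, n} = y'" "h {r', n'} = e"
      using dist rev by (simp_all add: h_def doubleton_eq_iff)
    have "bij_betw (color h) (star S x) T'" "bij_betw (color h) (star S w) T'"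
      "bij_betw (color h) (star S l) T'" "bij_betw (color h) (star S l') T'"
      "bij_betw (color h) (star S r) T'" "bij_betw (color h) (star S r') T'"
      "bij_betw (color h) (star S n) T'" "bij_betw (color h) (star S n') T'"
      unfolding stars y'(1) using y'(2,3) T'(4)
      by (intro bij_betw_three; simp only: color h True; simp add: insert_commute)+
    then have star_T': "bij_betw (color h) (star S v) T'" if "v \<in> superedge_verts S" for v
      using that unfolding verts by blast
    have ends_left: "\<forall>i\<in>{1, 2, 3}. color h (LeftEnd i) = ?lc i"
      and ends_right: "\<forall>i\<in>{1, 2, 3}. color h (RightEnd i) = ?rc i"
      by (simp_all add: color_def)
    have "superedge_coloring S T T' e ?lc ?rc (color h) (\<lambda>_. T')"
      using card_E T'(1) T(1) star_T' ends_left ends_right by (simp add: superedge_coloring_def True)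
    then show ?thesis by blast
  next
    case False
    then obtain y where y: "T = {e, z, y}" "y \<noteq> e" "y \<noteq> z"
      using card_3_third[of T e z] T by metis
    \<comment> \<open>the paths \<open>l - n - r - l'\<close> and \<open>x - w - n' - r'\<close> are joined by three edges, all of color \<open>e\<close>;
      the first path is colored with \<open>T\<close>, the second one with \<open>T'\<close>\<close>
    define h where "h f = (if f \<in> {{x, w}, {r', n'}} then y'
      else if f \<in> {{l, n}, {l', r}} then y else if f = {r, n} then z else if f = {w, n'} then z' else e)" for f
    have h: "h {x, w} = y'" "h {w, n} = e" "h {w, n'} = z'" "h {l, r'} = e" "h {l, n} = y"
      "h {l', r} = y" "h {l', n'} = e" "h {r, n} = z" "h {r', n'} = y'"
      using dist rev by (simp_all add: h_def doubleton_eq_iff)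
    define W where "W v = (if v \<in> {l, l', r, n} then T else T')" for v
    have W: "W x = T'" "W w = T'" "W l = T" "W l' = T" "W r = T" "W r' = T'" "W n = T" "W n' = T'"
      using dist rev by (simp_all add: W_def)
    have "bij_betw (color h) (star S x) T'" "bij_betw (color h) (star S w) T'"
      "bij_betw (color h) (star S l) T" "bij_betw (color h) (star S l') T"
      "bij_betw (color h) (star S r) T" "bij_betw (color h) (star S r') T'"
      "bij_betw (color h) (star S n) T" "bij_betw (color h) (star S n') T'"
      unfolding stars y'(1) y(1) using y'(2,3) y(2,3) T'(4) False
      by (intro bij_betw_three; simp only: color h; simp add: insert_commute)+
    then have star_W: "bij_betw (color h) (star S v) (W v)" if "v \<in> superedge_verts S" for v
      using that W unfolding verts by auto
    \<comment> \<open>These are the edges inside the two paths.\<close>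
    have "distinct [{x, w}, {w, n'}, {r', n'}, {l, n}, {l', r}, {r, n}]"
      using dist rev by (simp add: doubleton_eq_iff)
    from distinct_card[OF this]
    have "card {{x, w}, {w, n'}, {r', n'}, {l, n}, {l', r}, {r, n}} = 6"
      by (simp only: list.set list.size)
    moreover have "card {{x, w}, {w, n'}, {r', n'}, {l, n}, {l', r}, {r, n}} \<le>
      card {e \<in> superedge_edges S. \<forall>u\<in>e. \<forall>v\<in>e. W u = W v}"
      unfolding edges by (intro card_mono) (simp_all add: W)
    ultimately have six: "6 \<le> card {e \<in> superedge_edges S. \<forall>u\<in>e. \<forall>v\<in>e. W u = W v}"
      by (simp only:)
    have "W v \<in> {T, T'}" for v
      by (simp add: W_def)
    moreover have "\<forall>i\<in>{1, 2, 3}. color h (LeftEnd i) = ?lc i \<and> (W (lend S i) = T \<or> ?lc i = e)"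
      unfolding idx(1) using idx(3-6) by (auto simp: color_def ends W simp del: One_nat_def)
    moreover have "\<forall>i\<in>{1, 2, 3}. color h (RightEnd i) = ?rc i \<and> (W (rend S i) = T' \<or> ?rc i = e)"
      unfolding idx(2) using idx(3-6) by (auto simp: color_def ends W simp del: One_nat_def)
    ultimately have "superedge_coloring S T T' e ?lc ?rc (color h) W"
      using star_W six unfolding superedge_coloring_def by blast
    then show ?thesis by blast
  qed
qed

section \<open>Reflection of a superedge\<close>

definition mirror :: "superedge \<Rightarrow> superedge" where
  "mirror S = \<lparr>ldel = rdel S, rdel = ldel S, lend = rend S, rend = lend S\<rparr>"

fun flip :: "half_edge \<Rightarrow> half_edge" where
  "flip (Inner e) = Inner e"
| "flip (LeftEnd k) = RightEnd k"
| "flip (RightEnd k) = LeftEnd k"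

lemma petersen_superedge_mirror: "petersen_superedge S \<Longrightarrow> petersen_superedge (mirror S)"
  by (auto simp: petersen_superedge_def mirror_def insert_commute Int_commute)

text \<open>The requirements on the two sides are symmetric up to exchanging \<open>T\<close> and
  \<open>T'\<close>; \<open>flip\<close> renames the semiedges and fixes the inner edges.\<close>

lemma superedge_coloring_mirror:
  assumes "superedge_coloring (mirror S) T' T e rc lc \<chi> W"
  shows "superedge_coloring S T T' e lc rc (\<chi> \<circ> flip) W"
proof -
  have verts: "superedge_verts (mirror S) = superedge_verts S"
    and edges: "superedge_edges (mirror S) = superedge_edges S"
    by (auto simp: superedge_verts_def superedge_edges_def mirror_def)
  have "bij_betw flip (star S w) (star (mirror S) w)" for w
  proof (rule bij_betwI[of _ _ _ flip])
    show "flip \<in> star S w \<rightarrow> star (mirror S) w" "flip \<in> star (mirror S) w \<rightarrow> star S w"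
      unfolding star_def edges by (auto simp: mirror_def simp del: insert_iff)
    show "flip (flip x) = x" "flip (flip x) = x" for x
      by (cases x; simp)+
  qed
  then have "bij_betw (\<chi> \<circ> flip) (star S w) (W w)" if "w \<in> superedge_verts S" for w
    using assms that unfolding superedge_coloring_def verts
    by (intro bij_betw_trans[of flip _ "star (mirror S) w" \<chi>]) simp_all
  then show ?thesis
    using assms unfolding superedge_coloring_def verts edges by (auto simp: mirror_def)
qed

text \<open>Reflection reduces \<open>k = 1\<close> to the case of left special position 1. The
  reflected case needs \<open>z \<noteq> e\<close>, which is why \<open>z = e\<close> is tied to
  \<open>m = 1\<close>.\<close>

lemma superedge_coloring_exists:
  assumes S: "petersen_superedge S" and mk: "m \<in> {1, 2, 3}" "k \<in> {1, 2, 3}" "m = 1 \<longleftrightarrow> k \<noteq> 1"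
    and T: "card T = 3" "e \<in> T" "z \<in> T" "z = e \<longrightarrow> m = 1"
    and T': "card T' = 3" "e \<in> T'" "z' \<in> T'" "z' \<noteq> e"
  shows "\<exists>\<chi> W. superedge_coloring S T T' e
    (\<lambda>i. if i = m then e else z) (\<lambda>i. if i = k then e else z') \<chi> W"
proof (cases "m = 1")
  case True
  then show ?thesis
    using superedge_coloring_left[OF S _ T(1-3) T', of k] mk by auto
next
  case False
  then obtain \<chi> W where "superedge_coloring (mirror S) T' T e
      (\<lambda>i. if i = 1 then e else z') (\<lambda>i. if i = m then e else z) \<chi> W"
    using superedge_coloring_left[OF petersen_superedge_mirror[OF S] _ T'(1-3) T(1-3), of m] mk T(4) by auto
  then have "superedge_coloring S T T' e
      (\<lambda>i. if i = m then e else z) (\<lambda>i. if i = 1 then e else z') (\<chi> \<circ> flip) W"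
    by (rule superedge_coloring_mirror)
  moreover have "k = 1"
    using mk False by blast
  ultimately show ?thesis
    by blast
qed

section \<open>Cyclic indices and incidence facts\<close>

lemma cyc_pred_if: "i < g \<Longrightarrow> cyc_pred g i = (if i = 0 then g - 1 else i - 1)"
  by (auto simp: cyc_pred_def mod_if)

lemma Suc_mod_if: "i < g \<Longrightarrow> Suc i mod g = (if Suc i = g then 0 else Suc i)"
  by auto

lemma superedge_edge_verts:
  assumes "e \<in> superedge_edges S"
  obtains w w' where "e = {w, w'}" "w \<noteq> w'" "w \<in> superedge_verts S" "w' \<in> superedge_verts S"
proof -
  obtain A B where "e = {A, B}" "A \<in> verts petersen" "B \<in> verts petersen" "A \<inter> B = {}" "card A = 2"
    using assms by (auto simp: superedge_edges_def petersen_def Let_def)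
  moreover from this have "A \<noteq> B"
    by auto
  ultimately show thesis
    using assms that[of A B] by (auto simp add: superedge_edges_def superedge_verts_def eq_commute)
qed

text \<open>A neighbour of a deleted vertex is itself kept: the Petersen graph has no loops, and the
  two deleted vertices are nonadjacent.\<close>

lemma superedge_ends:
  assumes "petersen_superedge S" "k \<in> {1, 2, 3}"
  shows "lend S k \<in> superedge_verts S" "rend S k \<in> superedge_verts S"
proof -
  have lr: "lend S k \<in> neighbours petersen (ldel S)" "rend S k \<in> neighbours petersen (rdel S)"
    and nadj: "{ldel S, rdel S} \<notin> edges petersen"
    using petersen_superedgeD[OF assms(1)] assms(2) by (auto simp del: insert_iff dest!: bij_betwE)
  have "{v} \<notin> edges petersen" for v
    by (auto simp: petersen_def Let_def)
  then show "lend S k \<in> superedge_verts S" "rend S k \<in> superedge_verts S"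
    using lr nadj by (auto simp: superedge_verts_def neighbours_def insert_commute)
qed

lemma normal_edge_union:
  assumes "normal_edge_coloring k G \<sigma>" "{u, v} \<in> edges G"
  shows "card (colors_at G \<sigma> u \<union> colors_at G \<sigma> v) \<in> {3, 5}"
proof -
  obtain x y where "{u, v} = {x, y}" "card (colors_at G \<sigma> x \<union> colors_at G \<sigma> y) \<in> {3, 5}"
    using assms unfolding normal_edge_coloring_def poor_edge_def rich_edge_def by blast
  then show ?thesis
    by (auto simp: doubleton_eq_iff Un_commute)
qed

lemma proper_inj_on_incident:
  assumes "proper_edge_coloring k G \<sigma>"
  shows "inj_on \<sigma> (incident_edges G v)"
proof (rule inj_onI)
  fix e f assume "e \<in> incident_edges G v" "f \<in> incident_edges G v" "\<sigma> e = \<sigma> f"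
  then show "e = f"
    using assms unfolding proper_edge_coloring_def incident_edges_def by blast
qed

subsection \<open>Gluing the colorings of the superedges\<close>

text \<open>
  Names for the edges of the superposition. \<open>RightLink i k\<close> and \<open>LeftLink i k\<close> are the halves of the
  edge between the superedges \<open>i - 1\<close> and \<open>i\<close> at the \<open>k\<close>-th left semiedge of the latter; if this edge is not
  subdivided, only \<open>RightLink i k\<close> is used. \<open>Rung i\<close> is the edge \<open>u\<^sub>i'u\<^sub>i''\<close>.
\<close>

datatype 'a sp_edge = Old "'a set" | Inside nat "nat set set" | RightLink nat nat | LeftLink nat nat | Rung nat

locale superposition_data =
  fixes G :: "'a graph" and \<sigma> :: "'a set \<Rightarrow> nat" and g :: nat and c :: "nat \<Rightarrow> 'a" and S :: superedge
    and p :: "nat \<Rightarrow> nat \<Rightarrow> nat" and d :: "nat \<Rightarrow> nat" and t :: "nat \<Rightarrow> supervertex_type"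
    and nxt prv :: "nat \<Rightarrow> nat" and T :: "nat \<Rightarrow> nat set" and b :: "nat \<Rightarrow> nat"
  assumes simple: "simple_graph G" and cubic: "cubic G"
    and normal: "normal_edge_coloring 5 G \<sigma>" and cycle: "cycle_in G g c"
    and superedge: "petersen_superedge S"
    and perm: "\<And>i. i < g \<Longrightarrow> p i permutes {1, 2, 3}" and dock: "\<And>i. i < g \<Longrightarrow> d i \<in> {1, 2, 3}"
  defines "nxt \<equiv> \<lambda>i. Suc i mod g" and "prv \<equiv> cyc_pred g" and "T \<equiv> \<lambda>i. colors_at G \<sigma> (c i)"
    and "b \<equiv> \<lambda>i. \<sigma> {c i, c (nxt i)}"
begin

section \<open>The cycle and its colors in the original graph\<close>

lemma g: "3 \<le> g"
  using cycle by (simp add: cycle_in_def)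

lemma nxt_if: "i < g \<Longrightarrow> nxt i = (if Suc i = g then 0 else Suc i)"
  unfolding nxt_def by (rule Suc_mod_if)

lemma prv_if: "i < g \<Longrightarrow> prv i = (if i = 0 then g - 1 else i - 1)"
  unfolding prv_def by (rule cyc_pred_if)

text \<open>The last inequality needs \<open>3 \<le> g\<close>; it keeps the two cycle edges at
  \<open>c i\<close> distinct.\<close>

lemma prv_nxt:
  assumes "i < g"
  shows "nxt i < g" "prv i < g" "prv (nxt i) = i" "nxt (prv i) = i" "prv i \<noteq> i" "nxt i \<noteq> i" "nxt i \<noteq> prv i"
  using g assms by (auto simp: nxt_if prv_if)

lemma prv_eq_iff: "i < g \<Longrightarrow> j < g \<Longrightarrow> prv j = i \<longleftrightarrow> j = nxt i"
  using prv_nxt by metis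

lemma proper: "proper_edge_coloring 5 G \<sigma>"
  using normal by (simp add: normal_edge_coloring_def)

lemma c_in: "i < g \<Longrightarrow> c i \<in> verts G"
  using cycle by (simp add: cycle_in_def)

lemma c_eq_iff: "i < g \<Longrightarrow> j < g \<Longrightarrow> c i = c j \<longleftrightarrow> i = j"
  using cycle unfolding cycle_in_def by (auto dest: inj_onD)

lemma cycle_edge: "i < g \<Longrightarrow> {c i, c (nxt i)} \<in> edges G"
  using cycle by (simp add: cycle_in_def nxt_def)

lemma cycle_edge': "i < g \<Longrightarrow> {c (prv i), c i} \<in> edges G"
  using cycle_edge[of "prv i"] prv_nxt by simp

lemma b_prv: "i < g \<Longrightarrow> b (prv i) = \<sigma> {c (prv i), c i}"
  using prv_nxt by (simp add: b_def)

lemma cycle_edges_at: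
  assumes "i < g"
  shows "{e \<in> cycle_edges g c. c i \<in> e} = {{c (prv i), c i}, {c i, c (nxt i)}}"
proof
  show "{e \<in> cycle_edges g c. c i \<in> e} \<subseteq> {{c (prv i), c i}, {c i, c (nxt i)}}"
  proof
    fix e assume e: "e \<in> {e \<in> cycle_edges g c. c i \<in> e}"
    then obtain j where j: "j < g" "e = {c j, c (nxt j)}"
      by (auto simp: cycle_edges_def nxt_def)
    then have "i = j \<or> i = nxt j"
      using e assms prv_nxt(1)[OF j(1)] by (auto simp: c_eq_iff)
    then show "e \<in> {{c (prv i), c i}, {c i, c (nxt i)}}"
      using j prv_nxt by auto
  qed
  have "{c (prv i), c i} = {c (prv i), c (nxt (prv i))}"
    using prv_nxt(4)[OF assms] by simp
  then show "{{c (prv i), c i}, {c i, c (nxt i)}} \<subseteq> {e \<in> cycle_edges g c. c i \<in> e}"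
    using assms prv_nxt(2)[OF assms] unfolding cycle_edges_def nxt_def by blast
qed

lemma cycle_edges_neq: "i < g \<Longrightarrow> {c (prv i), c i} \<noteq> {c i, c (nxt i)}"
  using prv_nxt[of i] c_eq_iff by (auto simp: doubleton_eq_iff)

lemma b_neq:
  assumes "i < g"
  shows "b (prv i) \<noteq> b i"
proof -
  have "{c (prv i), c i} \<in> incident_edges G (c i)" "{c i, c (nxt i)} \<in> incident_edges G (c i)"
    using cycle_edge[OF assms] cycle_edge'[OF assms] by (auto simp: incident_edges_def)
  then show ?thesis
    using proper_inj_on_incident[OF proper, of "c i"] cycle_edges_neq[OF assms] b_prv[OF assms]
    by (auto simp: b_def dest: inj_onD)
qed

lemma card_colors_at:
  assumes "v \<in> verts G"
  shows "card (colors_at G \<sigma> v) = 3"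
  using assms cubic card_image[OF proper_inj_on_incident[OF proper]]
  by (simp add: colors_at_def cubic_def)

lemma card_T: "i < g \<Longrightarrow> card (T i) = 3"
  using card_colors_at c_in by (simp add: T_def)

text \<open>Equal sets give 3; different ones are the color sets at the ends of a cycle edge, which
  is poor or rich in \<open>G\<close>. This is the source of normality for the new edges.\<close>

lemma card_T_union:
  assumes "i < g" "A \<in> {T i, T (nxt i)}" "B \<in> {T i, T (nxt i)}"
  shows "card (A \<union> B) \<in> {3, 5}"
  using normal_edge_union[OF normal cycle_edge[OF assms(1)]] card_T[OF assms(1)]
    card_T[OF prv_nxt(1)[OF assms(1)]] assms(2,3)
  unfolding T_def by (auto simp: Un_commute)

section \<open>Colors at the supervertices\<close>

text \<open>Number of the right semiedge of superedge \<open>prv i\<close> that meets the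
  \<open>k\<close>-th left semiedge of superedge \<open>i\<close>. It allows both sides of a
  supervertex to be indexed by left semiedges.\<close>

definition q :: "nat \<Rightarrow> nat \<Rightarrow> nat" where
  "q i = inv (p (prv i))"

lemma q:
  assumes "i < g"
  shows "p (prv i) (q i k) = k" "q i (p (prv i) k) = k" "q i k \<in> {1, 2, 3} \<longleftrightarrow> k \<in> {1, 2, 3}"
  using permutes_inverses[OF perm[OF prv_nxt(2)[OF assms]]]
    permutes_in_image[OF permutes_inv[OF perm[OF prv_nxt(2)[OF assms]]]]
  by (simp_all only: q_def)

lemma p_in: "i < g \<Longrightarrow> p i j \<in> {1, 2, 3} \<longleftrightarrow> j \<in> {1, 2, 3}"
  using permutes_in_image[OF perm] .

lemma q_nxt: "i < g \<Longrightarrow> q (nxt i) (p i j) = j"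
  using q(2)[OF prv_nxt(1)[of i]] prv_nxt(3)[of i] by simp

lemma b_in_T:
  assumes "i < g"
  shows "b i \<in> T i" "b i \<in> T (nxt i)"
  using cycle_edge[OF assms] by (auto simp: T_def b_def colors_at_def incident_edges_def)

lemma T_eq:
  assumes i: "i < g"
  obtains f where "T i = {b (prv i), b i, f}" "f \<noteq> b (prv i)" "f \<noteq> b i"
  using card_3_third[OF card_T[OF i] _ b_in_T(1)[OF i] b_neq[OF i]] b_in_T(2)[OF prv_nxt(2)[OF i]] prv_nxt(4)[OF i]
  by auto

text \<open>\<open>R\<close> and \<open>L\<close> color the halves towards superedge
  \<open>prv i\<close> and superedge \<open>i\<close>, and \<open>Z\<close> is the color of the
  rung. The state \<open>s i\<close> says that the left special position of superedge
  \<open>i\<close> is 1; its right special position must then have the opposite status, hence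
  \<open>\<not> s (prv i)\<close> in the last conjunct.\<close>

definition good_link :: "(nat \<Rightarrow> bool) \<Rightarrow> nat \<Rightarrow> (nat \<Rightarrow> nat) \<Rightarrow> (nat \<Rightarrow> nat) \<Rightarrow> nat \<Rightarrow> bool" where
  "good_link s i R L Z \<longleftrightarrow> {R (d i), L (d i)} = {b (prv i), b i} \<and>
     (\<forall>k\<in>{1, 2, 3} - {d i}. (t i = Type_A \<longrightarrow> R k = L k) \<and> (t i = Type_A' \<longrightarrow> {R k, L k, Z} = T i)) \<and>
     (\<exists>m\<in>{1, 2, 3}. \<exists>z\<in>T i. (m = 1 \<longleftrightarrow> s i) \<and> (z = b i \<longrightarrow> m = 1) \<and>
       L = (\<lambda>j. if j = m then b i else z)) \<and>
     (\<exists>k\<in>{1, 2, 3}. \<exists>z\<in>T i. (k = 1 \<longleftrightarrow> \<not> s (prv i)) \<and> z \<noteq> b (prv i) \<and>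
       (\<lambda>j. R (p (prv i) j)) = (\<lambda>j. if j = k then b (prv i) else z))"

lemma good_link_exists:
  assumes i: "i < g" and notP: "\<not> s (prv i) \<Longrightarrow> p (prv i) 1 = 1 \<and> d i = 1 \<and> s i"
    and PQ: "s (prv i) \<Longrightarrow> s i \<Longrightarrow> p (prv i) 1 \<noteq> 1 \<or> d i \<noteq> 1"
  shows "\<exists>R L Z. good_link s i R L Z"
proof -
  obtain f where f: "T i = {b (prv i), b i, f}" "f \<noteq> b (prv i)" "f \<noteq> b i"
    using T_eq[OF i] .
  have p1: "p (prv i) 1 \<in> {1, 2, 3}"
    using p_in[OF prv_nxt(2)[OF i]] by blast
  obtain k m z z' y :: nat where km: "k \<in> {1, 2, 3}" "m \<in> {1, 2, 3}" "k = p (prv i) 1 \<longleftrightarrow> \<not> s (prv i)"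
      "m = 1 \<longleftrightarrow> s i" "z \<in> {b (prv i), b i, f}" "z = b i \<longrightarrow> m = 1" "z' \<in> {b i, f}"
    and link: "{if d i = k then b (prv i) else z', if d i = m then b i else z} = {b (prv i), b i}"
      "\<And>j. j \<in> {1, 2, 3} - {d i} \<Longrightarrow> t i = Type_A \<Longrightarrow>
         (if j = k then b (prv i) else z') = (if j = m then b i else z)"
      "\<And>j. j \<in> {1, 2, 3} - {d i} \<Longrightarrow> t i = Type_A' \<Longrightarrow>
         {if j = k then b (prv i) else z', if j = m then b i else z, y} = {b (prv i), b i, f}"
  proof (rule link_words[where a = "b (prv i)" and b = "b i" and f = f and \<delta> = "d i"
        and \<pi> = "p (prv i) 1" and P = "s (prv i)" and Q = "s i" and t = "t i"])
    show "b (prv i) \<noteq> b i" "b (prv i) \<noteq> f" "b i \<noteq> f"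
      using b_neq[OF i] f(2,3) by auto
  qed (assumption | rule dock[OF i] p1 notP PQ that)+
  \<comment> \<open>\<open>k\<close> is a position among left semiedges, while the last conjunct of
    \<open>good_link\<close> counts right semiedges; the witness there is
    \<open>q i k\<close>.\<close>
  have q_k: "q i k \<in> {1, 2, 3}" "p (prv i) j = k \<longleftrightarrow> j = q i k" for j
    using q[OF i] km(1) by metis+
  have "q i k = 1 \<longleftrightarrow> \<not> s (prv i)"
    using q_k(2)[of 1] km(3) by metis
  moreover have "z' \<in> T i" "z' \<noteq> b (prv i)"
    unfolding f(1) using km(7) b_neq[OF i] f(2) by auto
  moreover have "(\<lambda>j. if p (prv i) j = k then b (prv i) else z') = (\<lambda>j. if j = q i k then b (prv i) else z')"
    by (simp only: q_k(2))
  ultimately have right: "\<exists>k'\<in>{1, 2, 3}. \<exists>z\<in>T i. (k' = 1 \<longleftrightarrow> \<not> s (prv i)) \<and> z \<noteq> b (prv i) \<and>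
      (\<lambda>j. if p (prv i) j = k then b (prv i) else z') = (\<lambda>j. if j = k' then b (prv i) else z)"
    by (intro bexI[OF bexI[OF _ \<open>z' \<in> T i\<close>] q_k(1)] conjI)
  have "z \<in> T i"
    unfolding f(1) by (fact km(5))
  then have left: "\<exists>m'\<in>{1, 2, 3}. \<exists>z'\<in>T i. (m' = 1 \<longleftrightarrow> s i) \<and> (z' = b i \<longrightarrow> m' = 1) \<and>
      (\<lambda>j. if j = m then b i else z) = (\<lambda>j. if j = m' then b i else z')"
    by (intro bexI[OF bexI[OF _ \<open>z \<in> T i\<close>] km(2)] conjI km(4,6) refl)
  have "good_link s i (\<lambda>j. if j = k then b (prv i) else z') (\<lambda>j. if j = m then b i else z) y"
    unfolding good_link_def
    by (intro conjI ballI impI left right link(1)) (simp_all only: link(2,3) f(1))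
  then show ?thesis
    by blast
qed

lemma coloring_data_exists:
  assumes "\<exists>i<g. p i 1 \<noteq> 1 \<or> d i \<noteq> 1"
  obtains R L Z \<chi> W where "\<And>i. i < g \<Longrightarrow> {R i (d i), L i (d i)} = {b (prv i), b i}"
    "\<And>i k. i < g \<Longrightarrow> k \<in> {1, 2, 3} - {d i} \<Longrightarrow> t i = Type_A \<Longrightarrow> R i k = L i k"
    "\<And>i k. i < g \<Longrightarrow> k \<in> {1, 2, 3} - {d i} \<Longrightarrow> t i = Type_A' \<Longrightarrow> {R i k, L i k, Z i} = T i"
    "\<And>i. i < g \<Longrightarrow>
      superedge_coloring S (T i) (T (nxt i)) (b i) (L i) (\<lambda>j. R (nxt i) (p i j)) (\<chi> i) (W i)"
proof -
  \<comment> \<open>Supervertex \<open>i\<close> is governed by \<open>d i\<close> and by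
    \<open>p (prv i)\<close>. Hence a violation by \<open>p i\<close> makes the index
    \<open>nxt i\<close> exceptional, and one by \<open>d i\<close> the index
    \<open>i\<close>.\<close>
  define exc where "exc i \<longleftrightarrow> p (prv i) 1 \<noteq> 1 \<or> d i \<noteq> 1" for i
  obtain r where r: "r < g" "exc r"
    using assms prv_nxt unfolding exc_def by metis
  obtain s where s: "\<And>i. i < g \<Longrightarrow> exc (Suc i mod g) \<Longrightarrow> s i"
    "\<And>i. i < g \<Longrightarrow> \<not> exc (Suc i mod g) \<Longrightarrow> s i \<longleftrightarrow> \<not> s (Suc i mod g)"
    using alternating_states[of g r exc] r by auto
  have s': "exc i \<Longrightarrow> s (prv i)" "\<not> exc i \<Longrightarrow> s (prv i) \<longleftrightarrow> \<not> s i" if "i < g" for i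
    using s[of "prv i"] prv_nxt(2,4)[OF that] by (simp_all add: nxt_def)
  have "\<exists>R L Z. good_link s i R L Z" if i: "i < g" for i
    using s'[OF i] by (intro good_link_exists[OF i]) (auto simp: exc_def)
  then obtain R L Z where link: "\<And>i. i < g \<Longrightarrow> good_link s i (R i) (L i) (Z i)"
    by metis
  have "\<exists>\<chi> W. superedge_coloring S (T i) (T (nxt i)) (b i) (L i) (\<lambda>j. R (nxt i) (p i j)) \<chi> W"
    if i: "i < g" for i
  proof -
    obtain m z where m: "m \<in> {1, 2, 3}" "z \<in> T i" "m = 1 \<longleftrightarrow> s i" "z = b i \<longrightarrow> m = 1"
      "L i = (\<lambda>j. if j = m then b i else z)"
      using link[OF i] unfolding good_link_def by blast
    obtain k z' where k: "k \<in> {1, 2, 3}" "z' \<in> T (nxt i)" "k = 1 \<longleftrightarrow> \<not> s i" "z' \<noteq> b i"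
      "(\<lambda>j. R (nxt i) (p i j)) = (\<lambda>j. if j = k then b i else z')"
      using link[OF prv_nxt(1)[OF i]] unfolding good_link_def prv_nxt(3)[OF i] by blast
    \<comment> \<open>Both conditions refer to the same state \<open>s i\<close>, so exactly one
      special position is 1, as the superedge requires.\<close>
    have "m = 1 \<longleftrightarrow> k \<noteq> 1"
      using m(3) k(3) by blast
    then show ?thesis
      unfolding m(5) k(5)
      using superedge_coloring_exists[OF superedge m(1) k(1) _ card_T[OF i] b_in_T(1)[OF i] m(2,4)
          card_T[OF prv_nxt(1)[OF i]] b_in_T(2)[OF i] k(2,4)] by blast
  qed
  then obtain \<chi> W where
    "\<And>i. i < g \<Longrightarrow> superedge_coloring S (T i) (T (nxt i)) (b i) (L i) (\<lambda>j. R (nxt i) (p i j)) (\<chi> i) (W i)"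
    by metis
  moreover have "{R i (d i), L i (d i)} = {b (prv i), b i}" if "i < g" for i
    using link[OF that] unfolding good_link_def by blast
  moreover have "t i = Type_A \<Longrightarrow> R i k = L i k" "t i = Type_A' \<Longrightarrow> {R i k, L i k, Z i} = T i"
    if "i < g" "k \<in> {1, 2, 3} - {d i}" for i k
    using link[OF that(1)] that(2) unfolding good_link_def by blast+
  ultimately show thesis
    by (intro that)
qed

end

section \<open>Labelled edges and the prescribed color sets\<close>

locale superposition_coloring = superposition_data +
  fixes R L :: "nat \<Rightarrow> nat \<Rightarrow> nat" and Z :: "nat \<Rightarrow> nat"
    and \<chi> :: "nat \<Rightarrow> half_edge \<Rightarrow> nat" and WB :: "nat \<Rightarrow> nat set \<Rightarrow> nat set"
  assumes at_dock: "\<And>i. i < g \<Longrightarrow> {R i (d i), L i (d i)} = {b (prv i), b i}"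
    and at_A: "\<And>i k. i < g \<Longrightarrow> k \<in> {1, 2, 3} - {d i} \<Longrightarrow> t i = Type_A \<Longrightarrow> R i k = L i k"
    and at_A': "\<And>i k. i < g \<Longrightarrow> k \<in> {1, 2, 3} - {d i} \<Longrightarrow> t i = Type_A' \<Longrightarrow> {R i k, L i k, Z i} = T i"
    and coloring: "\<And>i. i < g \<Longrightarrow>
      superedge_coloring S (T i) (T (nxt i)) (b i) (L i) (\<lambda>j. R (nxt i) (p i j)) (\<chi> i) (WB i)"
begin

text \<open>Second end of \<open>RightLink i k\<close>; for an undivided link it already lies in
  superedge \<open>i\<close>. This treats all types of links uniformly.\<close>

definition far :: "nat \<Rightarrow> nat \<Rightarrow> 'a sp_vertex" where
  "far i k = (if k = d i then Base (c i) else if t i = Type_A' then Subdiv i k else Super i (lend S k))"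

definition ends :: "'a sp_edge \<Rightarrow> 'a sp_vertex set" where
  "ends l = (case l of Old e \<Rightarrow> Base ` e | Inside i e \<Rightarrow> Super i ` e
     | RightLink i k \<Rightarrow> {Super (prv i) (rend S (q i k)), far i k}
     | LeftLink i k \<Rightarrow> {far i k, Super i (lend S k)}
     | Rung i \<Rightarrow> Subdiv i ` ({1, 2, 3} - {d i}))"

lemma ends_simps [simp]:
  "ends (Old e) = Base ` e" "ends (Inside i f) = Super i ` f"
  "ends (RightLink i k) = {Super (prv i) (rend S (q i k)), far i k}"
  "ends (LeftLink i k) = {far i k, Super i (lend S k)}"
  "ends (Rung i) = Subdiv i ` ({1, 2, 3} - {d i})"
  by (simp_all add: ends_def)

definition X :: "'a sp_edge set" where
  "X = {l. case l of Old e \<Rightarrow> e \<in> edges G - cycle_edges g c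
     | Inside i e \<Rightarrow> i < g \<and> e \<in> superedge_edges S
     | RightLink i k \<Rightarrow> i < g \<and> k \<in> {1, 2, 3}
     | LeftLink i k \<Rightarrow> i < g \<and> k \<in> {1, 2, 3} \<and> (k = d i \<or> t i = Type_A')
     | Rung i \<Rightarrow> i < g \<and> t i = Type_A'}"

lemma X_simps [simp]:
  "Old e \<in> X \<longleftrightarrow> e \<in> edges G - cycle_edges g c"
  "Inside i f \<in> X \<longleftrightarrow> i < g \<and> f \<in> superedge_edges S"
  "RightLink i k \<in> X \<longleftrightarrow> i < g \<and> k \<in> {1, 2, 3}"
  "LeftLink i k \<in> X \<longleftrightarrow> i < g \<and> k \<in> {1, 2, 3} \<and> (k = d i \<or> t i = Type_A')"
  "Rung i \<in> X \<longleftrightarrow> i < g \<and> t i = Type_A'"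
  by (simp_all add: X_def)

definition \<kappa> :: "'a sp_edge \<Rightarrow> nat" where
  "\<kappa> l = (case l of Old e \<Rightarrow> \<sigma> e | Inside i e \<Rightarrow> \<chi> i (Inner e)
     | RightLink i k \<Rightarrow> R i k | LeftLink i k \<Rightarrow> L i k | Rung i \<Rightarrow> Z i)"

lemma \<kappa>_simps [simp]:
  "\<kappa> (Old e) = \<sigma> e" "\<kappa> (Inside i f) = \<chi> i (Inner f)"
  "\<kappa> (RightLink i k) = R i k" "\<kappa> (LeftLink i k) = L i k" "\<kappa> (Rung i) = Z i"
  by (simp_all add: \<kappa>_def)

definition W :: "'a sp_vertex \<Rightarrow> nat set" where
  "W v = (case v of Base x \<Rightarrow> colors_at G \<sigma> x | Super i w \<Rightarrow> WB i w | Subdiv i k \<Rightarrow> T i)"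

lemma W_simps [simp]:
  "W (Base x) = colors_at G \<sigma> x" "W (Super i w) = WB i w" "W (Subdiv i k) = T i"
  by (simp_all add: W_def)

text \<open>\<open>link_edges\<close> counts by right semiedges and the labels count by left ones;
  \<open>q i\<close> converts.\<close>

lemma link_edges_eq:
  assumes "i < g" "k \<in> {1, 2, 3}"
  shows "link_edges g c S p d t i (q i k) = ends ` ({RightLink i k, LeftLink i k} \<inter> X)"
  using assms q(1)[OF assms(1)]
  by (cases "k = d i"; cases "t i")
    (auto simp: link_edges_def Let_def far_def prv_def[symmetric])

lemma edges_superposition: "edges (superposition G g c S p d t) = ends ` X"
proof
  have links: "link_edges g c S p d t i j \<subseteq> ends ` X" if "i < g" "j \<in> {1, 2, 3}" for i j
  proof -
    have "p (prv i) j \<in> {1, 2, 3}"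
      using that prv_nxt(2) p_in by blast
    then show ?thesis
      using link_edges_eq[OF that(1), of "p (prv i) j"] q(2)[OF that(1)] by auto
  qed
  have "Base ` e \<in> ends ` X" if "e \<in> edges G - cycle_edges g c" for e
    using that by (intro image_eqI[of _ _ "Old e"]) simp_all
  then have "{Base ` e | e. e \<in> edges G - cycle_edges g c} \<subseteq> ends ` X"
    by blast
  moreover have "Super i ` e \<in> ends ` X" if "i < g" "e \<in> superedge_edges S" for i e
    using that by (intro image_eqI[of _ _ "Inside i e"]) simp_all
  then have "{Super i ` e | i e. i < g \<and> e \<in> superedge_edges S} \<subseteq> ends ` X"
    by blast
  moreover have "(\<Union>i\<in>{..<g}. \<Union>j\<in>{1, 2, 3}. link_edges g c S p d t i j) \<subseteq> ends ` X"
    by (intro UN_least links) simp_all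
  moreover have "Subdiv i ` ({1, 2, 3} - {d i}) \<in> ends ` X" if "i < g" "t i = Type_A'" for i
    using that by (intro image_eqI[of _ _ "Rung i"]) simp_all
  then have "{Subdiv i ` ({1, 2, 3} - {d i}) | i. i < g \<and> t i = Type_A'} \<subseteq> ends ` X"
    by blast
  ultimately show "edges (superposition G g c S p d t) \<subseteq> ends ` X"
    unfolding superposition_def graph.select_convs by (intro Un_least)
  have links': "ends l \<in> (\<Union>i\<in>{..<g}. \<Union>j\<in>{1, 2, 3}. link_edges g c S p d t i j)"
    if "l \<in> X" "l = RightLink i k \<or> l = LeftLink i k" for l i k
  proof -
    have ik: "i < g" "k \<in> {1, 2, 3}"
      using that by auto
    then have "ends l \<in> link_edges g c S p d t i (q i k)"
      using that link_edges_eq by auto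
    moreover have "q i k \<in> {1, 2, 3}"
      using ik q(3) by blast
    ultimately show ?thesis
      using ik by blast
  qed
  show "ends ` X \<subseteq> edges (superposition G g c S p d t)"
  proof (intro image_subsetI)
    fix l assume l: "l \<in> X"
    then show "ends l \<in> edges (superposition G g c S p d t)"
    proof (cases l)
      case (RightLink i k)
      then show ?thesis
        using links'[OF l, of i k] by (simp add: superposition_def del: ends_simps)
    next
      case (LeftLink i k)
      then show ?thesis
        using links'[OF l, of i k] by (simp add: superposition_def del: ends_simps)
    qed (auto simp: superposition_def)
  qed
qed

lemma lend_in: "k \<in> {1, 2, 3} \<Longrightarrow> lend S k \<in> superedge_verts S"
  and rend_in: "k \<in> {1, 2, 3} \<Longrightarrow> rend S k \<in> superedge_verts S"
  using superedge_ends[OF superedge] by blast+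

lemma coloringD:
  assumes "i < g"
  shows "w \<in> superedge_verts S \<Longrightarrow> WB i w \<in> {T i, T (nxt i)}"
    "w \<in> superedge_verts S \<Longrightarrow> bij_betw (\<chi> i) (star S w) (WB i w)"
    "k \<in> {1, 2, 3} \<Longrightarrow> \<chi> i (LeftEnd k) = L i k"
    "k \<in> {1, 2, 3} \<Longrightarrow> WB i (lend S k) = T i \<or> L i k = b i"
    "k \<in> {1, 2, 3} \<Longrightarrow> \<chi> i (RightEnd k) = R (nxt i) (p i k)"
    "k \<in> {1, 2, 3} \<Longrightarrow> WB i (rend S k) = T (nxt i) \<or> R (nxt i) (p i k) = b i"
    "6 \<le> card {e \<in> superedge_edges S. \<forall>u\<in>e. \<forall>v\<in>e. WB i u = WB i v}"
  using coloring[OF assms] unfolding superedge_coloring_def by blast+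

lemma right_end:
  assumes "i < g" "k \<in> {1, 2, 3}"
  shows "WB (prv i) (rend S (q i k)) \<in> {T (prv i), T i}"
    "WB (prv i) (rend S (q i k)) = T i \<or> R i k = b (prv i)"
proof -
  have "q i k \<in> {1, 2, 3}" "prv i < g" "nxt (prv i) = i" "p (prv i) (q i k) = k"
    using assms(2) q(1,3)[OF assms(1)] prv_nxt[OF assms(1)] by simp_all
  then show "WB (prv i) (rend S (q i k)) \<in> {T (prv i), T i}"
    "WB (prv i) (rend S (q i k)) = T i \<or> R i k = b (prv i)"
    using coloringD(1)[of "prv i" "rend S (q i k)"] coloringD(6)[of "prv i" "q i k"] rend_in by auto
qed

text \<open>Old edges inherit normality from \<open>\<sigma>\<close>. For every other edge the color
  sets at its ends belong to the ends of a single cycle edge; only an undivided link, which joins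
  two superedges directly, needs an argument.\<close>

lemma ends_doubleton:
  assumes "l \<in> X"
  shows "\<exists>u v. ends l = {u, v} \<and> u \<noteq> v \<and> card (W u \<union> W v) \<in> {3, 5}"
proof (cases l)
  case (Old e)
  then have "e \<in> edges G" "card e = 2"
    using assms simple by (auto simp: simple_graph_def)
  then obtain x y where "e = {x, y}" "x \<noteq> y"
    by (auto simp: card_2_iff)
  then show ?thesis
    using Old normal_edge_union[OF normal, of x y] \<open>e \<in> edges G\<close>
    by (intro exI[of _ "Base x"] exI[of _ "Base y"]) simp
next
  case (Inside i e)
  then have i: "i < g" and "e \<in> superedge_edges S"
    using assms by auto
  then obtain w w' where "e = {w, w'}" "w \<noteq> w'" "w \<in> superedge_verts S" "w' \<in> superedge_verts S"
    using superedge_edge_verts by metis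
  then show ?thesis
    using Inside card_T_union[OF i coloringD(1)[OF i] coloringD(1)[OF i], of w w']
    by (intro exI[of _ "Super i w"] exI[of _ "Super i w'"]) simp
next
  case (RightLink i k)
  then have ik: "i < g" "k \<in> {1, 2, 3}"
    using assms by auto
  let ?u = "Super (prv i) (rend S (q i k))"
  have near: "card (W ?u \<union> T i) \<in> {3, 5}"
    using card_T_union[of "prv i" "W ?u" "T i"] right_end(1)[OF ik] prv_nxt[OF ik(1)] by simp
  have "card (W ?u \<union> W (far i k)) \<in> {3, 5}"
  proof (cases "k = d i \<or> t i = Type_A'")
    case True
    then have "W (far i k) = T i"
      by (auto simp: far_def T_def)
    then show ?thesis
      using near by simp
  next
    case False
    then have "t i = Type_A" "k \<in> {1, 2, 3} - {d i}"
      using ik by (cases "t i"; auto)+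
    then have "R i k = L i k"
      using at_A ik by blast
    \<comment> \<open>The single color of the link cannot equal both \<open>b (prv i)\<close> and
      \<open>b i\<close>, so at least one end has color set \<open>T i\<close>. This excludes the
      pair \<open>T (prv i)\<close>, \<open>T (nxt i)\<close>, about which nothing is known.\<close>
    then have "WB (prv i) (rend S (q i k)) = T i \<or> WB i (lend S k) = T i"
      using right_end(2)[OF ik] coloringD(4)[OF ik] b_neq[OF ik(1)] by auto
    then show ?thesis
    proof
      assume "WB (prv i) (rend S (q i k)) = T i"
      then show ?thesis
        using False card_T_union[OF ik(1) _ coloringD(1)[OF ik(1) lend_in[OF ik(2)]], of "T i"]
        by (simp add: far_def)
    next
      assume "WB i (lend S k) = T i"
      then show ?thesis
        using False near by (simp add: far_def)
    qed
  qed
  moreover have "?u \<noteq> far i k"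
    using prv_nxt(5)[OF ik(1)] by (simp add: far_def)
  ultimately show ?thesis
    using RightLink by (intro exI[of _ ?u] exI[of _ "far i k"]) simp
next
  case (LeftLink i k)
  then have ik: "i < g" "k \<in> {1, 2, 3}" and far: "k = d i \<or> t i = Type_A'"
    using assms by auto
  have "W (far i k) = T i" "far i k \<noteq> Super i (lend S k)"
    using far by (auto simp: far_def T_def)
  then show ?thesis
    using LeftLink card_T_union[OF ik(1) _ coloringD(1)[OF ik(1) lend_in[OF ik(2)]], of "T i"]
    by (intro exI[of _ "far i k"] exI[of _ "Super i (lend S k)"]) simp
next
  case (Rung i)
  then have i: "i < g"
    using assms by auto
  have "card ({1, 2, 3} - {d i}) = 2"
    using dock[OF i] by simp
  then obtain k k' where "{1, 2, 3} - {d i} = {k, k'}" "k \<noteq> k'"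
    unfolding card_2_iff by auto
  then show ?thesis
    using Rung card_T[OF i] by (intro exI[of _ "Subdiv i k"] exI[of _ "Subdiv i k'"]) simp
qed

section \<open>The labels at each vertex and their colors\<close>

text \<open>An undivided link carries only the name \<open>RightLink\<close>, even when seen from
  its left semiedge.\<close>

definition \<psi> :: "nat \<Rightarrow> half_edge \<Rightarrow> 'a sp_edge" where
  "\<psi> i h = (case h of Inner e \<Rightarrow> Inside i e
     | LeftEnd k \<Rightarrow> if k = d i \<or> t i = Type_A' then LeftLink i k else RightLink i k
     | RightEnd j \<Rightarrow> RightLink (nxt i) (p i j))"

lemma labels_at_Super:
  assumes i: "i < g" and w: "w \<in> superedge_verts S"
  shows "{l \<in> X. Super i w \<in> ends l} = \<psi> i ` star S w"
proof (intro equalityI subsetI)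
  fix l assume l: "l \<in> {l \<in> X. Super i w \<in> ends l}"
  show "l \<in> \<psi> i ` star S w"
  proof (cases l)
    case (Inside j e)
    then show ?thesis
      using l by (intro image_eqI[of _ _ "Inner e"]) (auto simp: \<psi>_def star_def)
  next
    case (RightLink j k)
    then have jk: "j < g" "k \<in> {1, 2, 3}"
      using l by auto
    consider "prv j = i" "rend S (q j k) = w" | "far j k = Super i w"
      using l RightLink by auto
    then show ?thesis
    proof cases
      case 1
      then have "j = nxt i"
        using prv_eq_iff i jk by blast
      moreover have "q j k \<in> {1, 2, 3}" "p i (q j k) = k"
        using q[OF jk(1)] jk(2) 1(1) by blast+
      ultimately show ?thesis
        using 1(2) RightLink by (intro image_eqI[of _ _ "RightEnd (q j k)"]) (auto simp: \<psi>_def star_def)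
    next
      case 2
      then show ?thesis
        using RightLink jk
        by (intro image_eqI[of _ _ "LeftEnd k"]) (auto simp: \<psi>_def star_def far_def split: if_splits)
    qed
  next
    case (LeftLink j k)
    then show ?thesis
      using l by (intro image_eqI[of _ _ "LeftEnd k"]) (auto simp: \<psi>_def star_def far_def split: if_splits)
  qed (use l in auto)
next
  fix l assume "l \<in> \<psi> i ` star S w"
  then obtain h where h: "h \<in> star S w" "l = \<psi> i h"
    by blast
  show "l \<in> {l \<in> X. Super i w \<in> ends l}"
  proof (cases h)
    case (Inner e)
    then show ?thesis
      using h i by (auto simp: \<psi>_def star_def)
  next
    case (LeftEnd k)
    then show ?thesis
      using h i by (auto simp: \<psi>_def star_def far_def)
  next
    case (RightEnd j)
    then have j: "j \<in> {1, 2, 3}" "rend S j = w"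
      using h by (auto simp: star_def)
    then have "p i j \<in> {1, 2, 3}"
      using p_in i by blast
    then show ?thesis
      using h RightEnd j prv_nxt[OF i] q_nxt[OF i] by (simp add: \<psi>_def)
  qed
qed

lemma bij_at_Super:
  assumes i: "i < g" and w: "w \<in> superedge_verts S"
  shows "bij_betw \<kappa> {l \<in> X. Super i w \<in> ends l} (WB i w)"
proof -
  have \<kappa>\<psi>: "\<kappa> (\<psi> i h) = \<chi> i h" if "h \<in> star S w" for h
  proof (cases h)
    case (LeftEnd k)
    then have k: "k \<in> {1, 2, 3}"
      using that by (auto simp: star_def)
    show ?thesis
    proof (cases "k = d i \<or> t i = Type_A'")
      case False
      then have "t i = Type_A" "k \<in> {1, 2, 3} - {d i}"
        using k by (cases "t i"; auto)+
      then show ?thesis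
        using at_A[OF i] False LeftEnd coloringD(3)[OF i k] by (simp add: \<psi>_def)
    qed (use LeftEnd coloringD(3)[OF i k] in \<open>simp add: \<psi>_def\<close>)
  next
    case (RightEnd k)
    then have "k \<in> {1, 2, 3}"
      using that by (auto simp: star_def)
    then show ?thesis
      using RightEnd coloringD(5)[OF i] by (simp add: \<psi>_def)
  qed (simp add: \<psi>_def)
  \<comment> \<open>Bijectivity of the composite passes to \<open>\<kappa>\<close> on the image of
    the star under \<open>\<psi> i\<close>.\<close>
  have "bij_betw (\<kappa> \<circ> \<psi> i) (star S w) (WB i w)"
    using coloringD(2)[OF i w] \<kappa>\<psi> by (simp cong: bij_betw_cong)
  then show ?thesis
    unfolding labels_at_Super[OF i w] bij_betw_def
    by (auto simp: inj_on_def image_comp)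
qed

text \<open>Three labels map onto three colors, so injectivity comes for free.\<close>

lemma bij_at_Subdiv:
  assumes i: "i < g" and k: "k \<in> {1, 2, 3} - {d i}" and A': "t i = Type_A'"
  shows "bij_betw \<kappa> {l \<in> X. Subdiv i k \<in> ends l} (T i)"
proof -
  have at: "{l \<in> X. Subdiv i k \<in> ends l} = {RightLink i k, LeftLink i k, Rung i}"
  proof (intro equalityI subsetI)
    fix l assume "l \<in> {l \<in> X. Subdiv i k \<in> ends l}"
    then show "l \<in> {RightLink i k, LeftLink i k, Rung i}"
      by (cases l) (auto simp: far_def split: if_splits)
  qed (use i k A' in \<open>auto simp: far_def\<close>)
  show ?thesis
    unfolding at using at_A'[OF i k A'] card_T[OF i]
    by (intro bij_betw_of_card_le) (simp_all add: card_insert_if)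
qed

lemma labels_at_cycle:
  assumes i: "i < g"
  shows "{l \<in> X. Base (c i) \<in> ends l} = Old ` (incident_edges G (c i) - {{c (prv i), c i}, {c i, c (nxt i)}})
    \<union> {RightLink i (d i), LeftLink i (d i)}"
proof (intro equalityI subsetI)
  fix l assume l: "l \<in> {l \<in> X. Base (c i) \<in> ends l}"
  show "l \<in> Old ` (incident_edges G (c i) - {{c (prv i), c i}, {c i, c (nxt i)}})
    \<union> {RightLink i (d i), LeftLink i (d i)}"
  proof (cases l)
    case (Old e)
    then have "e \<in> edges G - cycle_edges g c" "c i \<in> e"
      using l by auto
    then show ?thesis
      using Old cycle_edges_at[OF i] by (auto simp: incident_edges_def)
  next
    case (RightLink j k)
    then have "j < g" "k = d j" "c j = c i"
      using l by (auto simp: far_def split: if_splits)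
    then show ?thesis
      using RightLink i c_eq_iff by auto
  next
    case (LeftLink j k)
    then have "j < g" "k = d j" "c j = c i"
      using l by (auto simp: far_def split: if_splits)
    then show ?thesis
      using LeftLink i c_eq_iff by auto
  qed (use l in auto)
next
  fix l assume "l \<in> Old ` (incident_edges G (c i) - {{c (prv i), c i}, {c i, c (nxt i)}})
    \<union> {RightLink i (d i), LeftLink i (d i)}"
  then consider e where "l = Old e" "e \<in> incident_edges G (c i)" "e \<notin> {{c (prv i), c i}, {c i, c (nxt i)}}"
    | "l = RightLink i (d i)" | "l = LeftLink i (d i)"
    by blast
  then show "l \<in> {l \<in> X. Base (c i) \<in> ends l}"
  proof cases
    case 1
    then have "e \<notin> cycle_edges g c"
      using cycle_edges_at[OF i] by (auto simp: incident_edges_def)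
    then show ?thesis
      using 1 by (auto simp: incident_edges_def)
  qed (use i dock[OF i] in \<open>auto simp: far_def\<close>)
qed

text \<open>At a cycle vertex the two halves at the dock take over the colors of the two cycle
  edges, in either order; away from the cycle nothing changes.\<close>

lemma bij_at_Base:
  assumes v: "v \<in> verts G"
  shows "bij_betw \<kappa> {l \<in> X. Base v \<in> ends l} (colors_at G \<sigma> v)"
proof (cases "\<exists>i<g. v = c i")
  case True
  then obtain i where i: "i < g" "v = c i"
    by blast
  let ?I = "incident_edges G (c i)" and ?C = "{{c (prv i), c i}, {c i, c (nxt i)}}"
  have C: "?C \<subseteq> ?I" "card ?C = 2"
    using cycle_edge[OF i(1)] cycle_edge'[OF i(1)] cycle_edges_neq[OF i(1)] by (auto simp: incident_edges_def)
  have I: "card ?I = 3"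
    using v cubic i(2) by (simp add: cubic_def)
  then have fin: "finite ?I"
    by (intro card_ge_0_finite) simp
  have "\<kappa> ` (Old ` (?I - ?C) \<union> {RightLink i (d i), LeftLink i (d i)})
      = \<sigma> ` (?I - ?C) \<union> {R i (d i), L i (d i)}"
    by (simp only: image_Un image_image image_insert image_empty \<kappa>_simps)
  also note at_dock[OF i(1)]
  also have "{b (prv i), b i} = \<sigma> ` ?C"
    using b_prv[OF i(1)] by (simp add: b_def)
  also have "\<sigma> ` (?I - ?C) \<union> \<sigma> ` ?C = colors_at G \<sigma> v"
    using C(1) unfolding colors_at_def i(2) by blast
  finally have "\<kappa> ` {l \<in> X. Base v \<in> ends l} = colors_at G \<sigma> v"
    unfolding i(2) labels_at_cycle[OF i(1)] .
  moreover have "card {l \<in> X. Base v \<in> ends l} \<le> 3"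
  proof -
    have "card (?I - ?C) = 1"
      using C I fin by (simp add: card_Diff_subset)
    then have "card (Old ` (?I - ?C)) \<le> 1"
      using card_image_le[of "?I - ?C" Old] fin by simp
    moreover have "card {RightLink i (d i), LeftLink i (d i)} \<le> 2"
      by (simp add: card_insert_if)
    ultimately show ?thesis
      unfolding i(2) labels_at_cycle[OF i(1)] by (intro order_trans[OF card_Un_le]) simp
  qed
  moreover have "finite {l \<in> X. Base v \<in> ends l}"
    unfolding i(2) labels_at_cycle[OF i(1)] using fin by simp
  ultimately show ?thesis
    using card_colors_at[OF v] by (intro bij_betw_of_card_le) simp_all
next
  case False
  have "v \<notin> e" if e: "e \<in> cycle_edges g c" for e
  proof -
    obtain j where j: "j < g" "e = {c j, c (nxt j)}"
      using e by (auto simp: cycle_edges_def nxt_def)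
    show ?thesis
      using False j(1) prv_nxt(1)[OF j(1)] unfolding j(2) by blast
  qed
  then have "{l \<in> X. Base v \<in> ends l} = Old ` incident_edges G v"
  proof (intro equalityI subsetI)
    fix l assume "l \<in> {l \<in> X. Base v \<in> ends l}"
    then show "l \<in> Old ` incident_edges G v"
      using False by (cases l) (auto simp: incident_edges_def far_def split: if_splits)
  qed (auto simp: incident_edges_def)
  then show ?thesis
    using proper_inj_on_incident[OF proper, of v]
    by (auto simp: bij_betw_def colors_at_def inj_on_def image_image)
qed

section \<open>Distinct labels name distinct edges\<close>

lemma rend_inj: "j \<in> {1, 2, 3} \<Longrightarrow> k \<in> {1, 2, 3} \<Longrightarrow> rend S j = rend S k \<Longrightarrow> j = k"
  and lend_inj: "j \<in> {1, 2, 3} \<Longrightarrow> k \<in> {1, 2, 3} \<Longrightarrow> lend S j = lend S k \<Longrightarrow> j = k"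
  using petersen_superedgeD(4,5)[OF superedge] unfolding bij_betw_def by (metis inj_onD)+

lemma far_eq:
  assumes "far i k = far j k'" "i < g" "j < g"
  shows "i = j"
  using assms c_eq_iff by (auto simp: far_def split: if_splits)

lemma far_Super: "far i k = Super j w \<Longrightarrow> i = j \<and> \<not> (k = d i \<or> t i = Type_A')"
  by (auto simp: far_def split: if_splits)

text \<open>Edges are vertex sets, so two labels with the same ends would be one edge with two
  prescribed colors. Kinds and indices of the ends separate most labels; links with the same index
  are separated by injectivity of \<open>lend S\<close> and \<open>rend S\<close>.\<close>

lemma inj_ends: "inj_on ends X"
proof -
  have old: "l = Old e" if l: "l \<in> X" "Old e \<in> X" and eq: "ends l = ends (Old e)" for l e
  proof -
    have all: "\<forall>v\<in>ends l. \<exists>y. v = Base y"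
      using eq by auto
    obtain u where u: "u \<in> ends l"
      using ends_doubleton[OF l(1)] by auto
    show ?thesis
      using all u eq by (cases l) (auto simp: inj_image_eq_iff inj_on_def)
  qed
  have inside: "l = Inside i e" if l: "l \<in> X" "Inside i e \<in> X" and eq: "ends l = ends (Inside i e)" for l i e
  proof -
    have all: "\<forall>v\<in>ends l. \<exists>y. v = Super i y"
      using eq by auto
    obtain u where u: "u \<in> ends l"
      using ends_doubleton[OF l(1)] by auto
    show ?thesis
    proof (cases l)
      case (Inside j f)
      then have "j = i"
        using all u by auto
      then show ?thesis
        using Inside eq by (simp add: inj_image_eq_iff inj_on_def)
    next
      case (RightLink j k)
      then have "prv j = i" "\<exists>y. far j k = Super i y" "j < g"
        using all l(1) by auto
      moreover from this have "j = i"
        using far_Super by blast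
      ultimately show ?thesis
        using prv_nxt(5)[of j] by simp
    next
      case (LeftLink j k)
      then have "\<exists>y. far j k = Super i y" "k = d j \<or> t j = Type_A'"
        using all l(1) by auto
      then show ?thesis
        using far_Super by blast
    qed (use all u in auto)
  qed
  have rung: "l = Rung i" if l: "l \<in> X" "Rung i \<in> X" and eq: "ends l = ends (Rung i)" for l i
  proof -
    have all: "\<forall>v\<in>ends l. \<exists>y. v = Subdiv i y"
      using eq by auto
    obtain u where u: "u \<in> ends l"
      using ends_doubleton[OF l(1)] by auto
    show ?thesis
      using all u by (cases l) auto
  qed
  have right_left: False
    if l: "RightLink i k \<in> X" "LeftLink j k' \<in> X" and eq: "ends (RightLink i k) = ends (LeftLink j k')"
    for i k j k'
  proof -
    have "far j k' \<noteq> Super h w" "Super h w \<noteq> far j k'" for h w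
      using l(2) far_Super[of j k' h w] by auto
    then have "Super (prv i) (rend S (q i k)) = Super j (lend S k')" "far i k = far j k'"
      using eq by (auto simp: doubleton_eq_iff)
    then have "prv i = j" "i = j"
      using far_eq l by auto
    then show False
      using prv_nxt(5)[of i] l by auto
  qed
  have right: "RightLink i k = RightLink j k'"
    if l: "RightLink i k \<in> X" "RightLink j k' \<in> X" and eq: "ends (RightLink i k) = ends (RightLink j k')"
    for i k j k'
  proof -
    have ij: "i < g" "j < g" "k \<in> {1, 2, 3}" "k' \<in> {1, 2, 3}"
      using l by auto
    \<comment> \<open>A crosswise match would give \<open>prv i = j\<close> and
      \<open>prv j = i\<close>, hence \<open>nxt i = prv i\<close>.\<close>
    have "\<not> (Super (prv i) (rend S (q i k)) = far j k' \<and> far i k = Super (prv j) (rend S (q j k')))"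
      using far_Super[of j k' "prv i"] far_Super[of i k "prv j"] prv_nxt[OF ij(1)] prv_eq_iff[OF ij(1,2)] by metis
    then have *: "prv i = prv j" "rend S (q i k) = rend S (q j k')"
      using eq by (auto simp: doubleton_eq_iff)
    then have "i = j"
      using prv_nxt(4) ij by metis
    moreover have "q i k \<in> {1, 2, 3}" "q j k' \<in> {1, 2, 3}"
      using q(3) ij by blast+
    then have "q i k = q j k'"
      using *(2) rend_inj by blast
    ultimately show ?thesis
      using q(1)[OF ij(1)] by metis
  qed
  have left: "LeftLink i k = LeftLink j k'"
    if l: "LeftLink i k \<in> X" "LeftLink j k' \<in> X" and eq: "ends (LeftLink i k) = ends (LeftLink j k')"
    for i k j k'
  proof -
    have "far j k' \<noteq> Super h w" "Super h w \<noteq> far j k'" for h w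
      using l(2) far_Super[of j k' h w] by auto
    then have "Super i (lend S k) = Super j (lend S k')"
      using eq by (auto simp: doubleton_eq_iff)
    then show ?thesis
      using l lend_inj by (simp del: insert_iff)
  qed
  show ?thesis
  proof (rule inj_onI)
    fix l l' assume l: "l \<in> X" "l' \<in> X" and eq: "ends l = ends l'"
    show "l = l'"
    proof (cases l)
      case (Old e)
      then show ?thesis
        using old[of l' e] l eq by metis
    next
      case (Inside i e)
      then show ?thesis
        using inside[of l' i e] l eq by metis
    next
      case l1: (RightLink i k)
      show ?thesis
      proof (cases l')
        case (RightLink j k')
        then show ?thesis
          using right[of i k j k'] l eq l1 by metis
      next
        case (LeftLink j k')
        then show ?thesis
          using right_left[of i k j k'] l eq l1 by metis
      next
        case (Old e)
        then show ?thesis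
          using old[of l e] l eq by metis
      next
        case (Inside j e)
        then show ?thesis
          using inside[of l j e] l eq by metis
      next
        case (Rung j)
        then show ?thesis
          using rung[of l j] l eq by metis
      qed
    next
      case l1: (LeftLink i k)
      show ?thesis
      proof (cases l')
        case (RightLink j k')
        then show ?thesis
          using right_left[of j k' i k] l eq l1 by metis
      next
        case (LeftLink j k')
        then show ?thesis
          using left[of i k j k'] l eq l1 by metis
      next
        case (Old e)
        then show ?thesis
          using old[of l e] l eq by metis
      next
        case (Inside j e)
        then show ?thesis
          using inside[of l j e] l eq by metis
      next
        case (Rung j)
        then show ?thesis
          using rung[of l j] l eq by metis
      qed
    next
      case (Rung i)
      then show ?thesis
        using rung[of l' i] l eq by metis
    qed
  qed
qed

section \<open>Normality and the count of poor edges\<close>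

lemma normal_coloring:
  obtains \<tau> where "normal_edge_coloring 5 (superposition G g c S p d t) \<tau>"
    "18 \<le> card {e \<in> edges (superposition G g c S p d t). poor_edge (superposition G g c S p d t) \<tau> e}"
proof -
  let ?H = "superposition G g c S p d t"
  have local: "bij_betw \<kappa> {l \<in> X. v \<in> ends l} (W v) \<and> W v \<subseteq> {1..5}" if v: "v \<in> \<Union>(ends ` X)" for v
  proof -
    have colors: "colors_at G \<sigma> x \<subseteq> {1..5}" for x
      using proper unfolding proper_edge_coloring_def colors_at_def incident_edges_def by blast
    obtain l where l: "l \<in> X" "v \<in> ends l"
      using v by blast
    define vertex where "vertex v \<longleftrightarrow> (\<exists>x\<in>verts G. v = Base x) \<or> (\<exists>i<g. \<exists>w\<in>superedge_verts S. v = Super i w)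
        \<or> (\<exists>i<g. \<exists>k\<in>{1, 2, 3} - {d i}. v = Subdiv i k \<and> t i = Type_A')" for v :: "'a sp_vertex"
    have super: "vertex (Super i w)" if "i < g" "w \<in> superedge_verts S" for i w
      using that unfolding vertex_def by blast
    have far: "vertex (far i k)" if ik: "i < g" "k \<in> {1, 2, 3}" for i k
    proof -
      consider "far i k = Base (c i)" | "far i k = Subdiv i k" "k \<in> {1, 2, 3} - {d i}" "t i = Type_A'"
        | "far i k = Super i (lend S k)"
        using ik(2) unfolding far_def by (cases "k = d i"; cases "t i = Type_A'") simp_all
      then show ?thesis
        by cases (use ik c_in lend_in in \<open>unfold vertex_def, blast+\<close>)
    qed
    have "vertex v"
    proof (cases l)
      case (Old e)
      then have "e \<in> edges G" "v \<in> Base ` e"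
        using l by auto
      moreover from this have "e \<subseteq> verts G"
        using simple by (simp add: simple_graph_def)
      ultimately show ?thesis
        unfolding vertex_def by auto
    next
      case (Inside i e)
      then have "i < g" "e \<in> superedge_edges S" "v \<in> Super i ` e"
        using l by auto
      then show ?thesis
        using super by (elim superedge_edge_verts) auto
    next
      case (RightLink i k)
      then have ik: "i < g" "k \<in> {1, 2, 3}" and v: "v = Super (prv i) (rend S (q i k)) \<or> v = far i k"
        using l by auto
      then have "q i k \<in> {1, 2, 3}"
        using q(3) by blast
      then show ?thesis
        using v far[OF ik] super[OF prv_nxt(2)[OF ik(1)] rend_in] by blast
    next
      case (LeftLink i k)
      then have ik: "i < g" "k \<in> {1, 2, 3}" and v: "v = Super i (lend S k) \<or> v = far i k"
        using l by auto
      then show ?thesis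
        using far super lend_in by blast
    next
      case (Rung i)
      then have "i < g" "t i = Type_A'" "v \<in> Subdiv i ` ({1, 2, 3} - {d i})"
        using l by simp_all
      then show ?thesis
        unfolding vertex_def by blast
    qed
    then show ?thesis
      unfolding vertex_def
    proof (elim disjE bexE exE conjE)
      fix x assume "x \<in> verts G" "v = Base x"
      then show ?thesis
        using bij_at_Base colors by simp
    next
      fix i w assume iw: "i < g" "w \<in> superedge_verts S" "v = Super i w"
      have "WB i w \<subseteq> {1..5}"
        using coloringD(1)[OF iw(1,2)] colors by (auto simp: T_def)
      then show ?thesis
        using bij_at_Super[OF iw(1,2)] iw(3) by simp
    next
      fix i k assume "i < g" "k \<in> {1, 2, 3} - {d i}" "v = Subdiv i k" "t i = Type_A'"
      then show ?thesis
        using bij_at_Subdiv colors by (simp add: T_def)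
    qed
  qed
  obtain \<tau> where \<tau>: "normal_edge_coloring 5 ?H \<tau>"
    "\<And>l u v. l \<in> X \<Longrightarrow> ends l = {u, v} \<Longrightarrow> card (W u \<union> W v) = 3 \<Longrightarrow> poor_edge ?H \<tau> (ends l)"
  proof (rule normal_edge_coloring_by_labels[OF edges_superposition inj_ends, of \<kappa> W])
    show "bij_betw \<kappa> {l \<in> X. v \<in> ends l} (W v)" "W v \<subseteq> {1..5}" if "v \<in> \<Union>(ends ` X)" for v
      using local[OF that] by simp_all
    show "\<exists>u v. ends l = {u, v} \<and> card (W u \<union> W v) \<in> {3, 5}" if "l \<in> X" for l
      using ends_doubleton[OF that] by blast
  qed (rule that)
  define P where "P i = {e \<in> superedge_edges S. \<forall>u\<in>e. \<forall>v\<in>e. WB i u = WB i v}" for i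
  have "finite (verts petersen)"
    by (rule finite_subset[of _ "Pow {..<5}"]) (auto simp: petersen_def Let_def)
  moreover have "edges petersen \<subseteq> Pow (verts petersen)"
    by (auto simp: petersen_def Let_def)
  ultimately have "finite (superedge_edges S)"
    unfolding superedge_edges_def by (simp add: finite_subset)
  then have fin_P: "finite (P i)" for i
    by (simp add: P_def)
  \<comment> \<open>Only edges inside superedges with equal color sets at both ends are counted;
    \<open>inj_ends\<close> ensures that they remain distinct in the superposition.\<close>
  let ?M = "(\<lambda>(i, e). Inside i e) ` (SIGMA i:{..<g}. P i) :: 'a sp_edge set"
  have M: "?M \<subseteq> X"
    by (auto simp: P_def)
  have "18 \<le> (\<Sum>i<g. 6::nat)"
    using g by simp
  also have "\<dots> \<le> (\<Sum>i<g. card (P i))"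
    using coloringD(7) by (intro sum_mono) (simp add: P_def)
  also have "\<dots> = card (SIGMA i:{..<g}. P i)"
    using fin_P by simp
  also have "\<dots> = card ?M"
    by (rule card_image[symmetric]) (auto simp: inj_on_def)
  also have "\<dots> = card (ends ` ?M)"
    by (rule card_image[OF inj_on_subset[OF inj_ends M], symmetric])
  also have "\<dots> \<le> card {e \<in> edges ?H. poor_edge ?H \<tau> e}"
  proof (rule card_mono)
    \<comment> \<open>\<open>card\<close> is 0 on infinite sets, so the comparison requires finitely
      many labels.\<close>
    have "finite (edges G)"
      using simple by (intro finite_subset[of "edges G" "Pow (verts G)"]) (auto simp: simple_graph_def)
    moreover have "X \<subseteq> Old ` edges G \<union> (\<lambda>(i, e). Inside i e) ` ({..<g} \<times> superedge_edges S)
        \<union> (\<lambda>(i, k). RightLink i k) ` ({..<g} \<times> {1, 2, 3})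
        \<union> (\<lambda>(i, k). LeftLink i k) ` ({..<g} \<times> {1, 2, 3}) \<union> Rung ` {..<g}"
    proof
      fix l assume "l \<in> X"
      then show "l \<in> Old ` edges G \<union> (\<lambda>(i, e). Inside i e) ` ({..<g} \<times> superedge_edges S)
        \<union> (\<lambda>(i, k). RightLink i k) ` ({..<g} \<times> {1, 2, 3})
        \<union> (\<lambda>(i, k). LeftLink i k) ` ({..<g} \<times> {1, 2, 3}) \<union> Rung ` {..<g}"
        by (cases l) auto
    qed
    ultimately have "finite X"
      using \<open>finite (superedge_edges S)\<close> by (auto elim: finite_subset)
    then show "finite {e \<in> edges ?H. poor_edge ?H \<tau> e}"
      using edges_superposition by simp
    show "ends ` ?M \<subseteq> {e \<in> edges ?H. poor_edge ?H \<tau> e}"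
    proof
      fix e assume "e \<in> ends ` ?M"
      then obtain i f where if': "i < g" "f \<in> P i" "e = ends (Inside i f)"
        by auto
      have f: "f \<in> superedge_edges S" "\<forall>u\<in>f. \<forall>v\<in>f. WB i u = WB i v"
        using if'(2) unfolding P_def by blast+
      obtain w w' where w: "f = {w, w'}" "w \<in> superedge_verts S" "w' \<in> superedge_verts S"
        using superedge_edge_verts[OF f(1)] by metis
      \<comment> \<open>The union of two equal color sets has three elements, which makes the edge
        poor.\<close>
      have "card (WB i w) = 3"
        using coloringD(1)[OF if'(1) w(2)] card_T if'(1) prv_nxt(1) by auto
      moreover have "WB i w = WB i w'"
        using f(2) unfolding w(1) by blast
      ultimately have "poor_edge ?H \<tau> e"
        using \<tau>(2)[of "Inside i f" "Super i w" "Super i w'"] if'(1,3) f(1) w(1) by simp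
      then show "e \<in> {e \<in> edges ?H. poor_edge ?H \<tau> e}"
        by (simp add: poor_edge_def)
    qed
  qed
  finally show thesis
    using \<tau>(1) that by blast
qed

end

theorem theorem3:
  fixes G :: "'a graph"
    and \<sigma> :: "'a set \<Rightarrow> nat"
    and g :: nat
    and c :: "nat \<Rightarrow> 'a"
    and S :: superedge
    and p :: "nat \<Rightarrow> nat \<Rightarrow> nat"
    and d :: "nat \<Rightarrow> nat"
    and t :: "nat \<Rightarrow> supervertex_type"
    and G' :: "'a sp_vertex graph"
  assumes "snark G"
    and "normal_edge_coloring 5 G \<sigma>"
    and "cycle_in G g c"
    and "petersen_superedge S"
    and "\<forall>i<g. p i permutes {1, 2, 3}"
    and "\<forall>i<g. d i \<in> {1, 2, 3}"
    and "G' = superposition G g c S p d t"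
    and "\<exists>i<g. p i 1 \<noteq> 1 \<or> d i \<noteq> 1"
  shows "\<exists>\<tau>. normal_edge_coloring 5 G' \<tau> \<and> 18 \<le> card {e \<in> edges G'. poor_edge G' \<tau> e}"
proof -
  define nxt prv where "nxt = (\<lambda>i. Suc i mod g)" and "prv = cyc_pred g"
  define T b where "T = (\<lambda>i. colors_at G \<sigma> (c i))" and "b = (\<lambda>i. \<sigma> {c i, c (nxt i)})"
  note defs = nxt_def prv_def T_def b_def
  have G: "simple_graph G" "cubic G"
    using assms(1) by (simp_all add: snark_def)
  interpret superposition_data G \<sigma> g c S p d t nxt prv T b
    by unfold_locales (use G assms(2-6) in \<open>simp_all only: defs\<close>)
  obtain R L Z \<chi> W where data: "\<And>i. i < g \<Longrightarrow> {R i (d i), L i (d i)} = {b (prv i), b i}"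
    "\<And>i k. i < g \<Longrightarrow> k \<in> {1, 2, 3} - {d i} \<Longrightarrow> t i = Type_A \<Longrightarrow> R i k = L i k"
    "\<And>i k. i < g \<Longrightarrow> k \<in> {1, 2, 3} - {d i} \<Longrightarrow> t i = Type_A' \<Longrightarrow> {R i k, L i k, Z i} = T i"
    "\<And>i. i < g \<Longrightarrow>
      superedge_coloring S (T i) (T (nxt i)) (b i) (L i) (\<lambda>j. R (nxt i) (p i j)) (\<chi> i) (W i)"
    using coloring_data_exists[OF assms(8)] by blast
  interpret superposition_coloring G \<sigma> g c S p d t nxt prv T b R L Z \<chi> W
    by unfold_locales (fact data[unfolded defs])+
  show ?thesis
    using normal_coloring assms(7) by blast
qed

end
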